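(* Let $\mathcal{H}$ be a compact set of strictly $\gamma_k$-feasible channels, let $\rho>0$, and let initial values $\boldsymbol{\tau}^{[0]},\boldsymbol{\nu}^{[0]}$ with $\mathbf{E}^T\boldsymbol{\nu}^{[0]}=\mathbf{0}$ be given. Assume: (A1) $\boldsymbol{\tau}^\star(\mathbf{H})$ is a continuous function of $\mathbf{H}$ over $\mathcal{H}$; (A2) $\boldsymbol{\nu}^\star(\mathbf{H})$ is a continuous function of $\mathbf{H}$ over $\mathcal{H}$; (A3) the primal iterates $\mathbf{W}^{[i]}$, $\mathbf{t}^{[i]}$, $\boldsymbol{\tau}^{[i]}$ produced by one ADMM iteration are continuous functions of the inputs $(\boldsymbol{\tau}^{[i-1]},\boldsymbol{\nu}^{[i-1]},\mathbf{H}^{[i]})$. Then, given a constant $c>0$, there exists a maximum channel variation $\delta>0$ such that for every sequence $\{\mathbf{H}^{[i]}\}_{i\ge0}$ with $\mathbf{H}^{[i-1]}\in\mathcal{H}$ and $\|\mathbf{H}^{[i]}-\mathbf{H}^{[i-1]}\|\le\delta$ for all $i\ge1$, the iterates of the dynamic ADMM algorithm satisfy $$\limsup_{i\to\infty}V(\boldsymbol{\nu}^{[i-1]},\boldsymbol{\tau}^{[i-1]},\mathbf{H}^{[i]})\le c .$$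
   Context: Network. There are $B$ base stations with $N_T$ antennas each and $K$ single-antenna users. User $k$ is served by base station $b(k)$, and $\mathcal{U}(b)=\{k: b(k)=b\}$. $\mathbf{h}_{mk}\in\mathbb{C}^{N_T}$ is the channel from base station $m$ to user $k$, $\mathbf{H}$ is the collection of all $\mathbf{h}_{mk}$ (with $\|\cdot\|$ any fixed norm), $\mathbf{w}_k\in\mathbb{C}^{N_T}$ is the beam-former for user $k$, and $\mathbf{W}=(\mathbf{w}_1,\dots,\mathbf{w}_K)$. Noise variances $\sigma_k^2>0$ and targets $\gamma_k>0$ are fixed. Define $$\mathrm{SINR}_k(\mathbf{W},\mathbf{H})=\frac{|\mathbf{h}_{b(k)k}^H\mathbf{w}_k|^2}{\sum_{i\in\mathcal{U}(b(k))\setminus k}|\mathbf{h}_{b(k)k}^H\mathbf{w}_i|^2+\sum_{m\ne b(k)}\sum_{i\in\mathcal{U}(m)}|\mathbf{h}_{mk}^H\mathbf{w}_i|^2+\sigma_k^2}.$$ Phase convention: everywhere beam-formers are normalized so that $\mathbf{h}_{b(k)k}^H\mathbf{w}_k$ is real and nonnegative (this makes the SINR constraints second-order cone constraints). $\mathbf{H}$ is strictly $\gamma_k$-feasible if there is $\mathbf{W}$ with $\mathrm{SINR}_k(\mathbf{W},\mathbf{H})>\gamma_k$ for all $k$. Distributed formulation. For each user $k$ and each $m\ne b(k)$ there are two real copies $t_{mk}^{(m)}$ (held by $m$) and $t_{mk}^{(b(k))}$ (held by $b(k)$) of the interference amplitude caused by base station $m$ on user $k$, and one consistency variable $\tau_{mk}\in\mathbb{R}$.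 $\mathbf{t}_b$ collects the copies held by base station $b$, i.e. $t_{bj}^{(b)}$ for $j\notin\mathcal{U}(b)$ and $t_{mk}^{(b)}$ for $k\in\mathcal{U}(b)$, $m\ne b$. $\mathbf{t}=(\mathbf{t}_1,\dots,\mathbf{t}_B)\in\mathbb{R}^{2(B-1)K}$ and $\boldsymbol{\tau}\in\mathbb{R}^{(B-1)K}$ collect everything. $\mathbf{E}$ is the $2(B-1)K\times(B-1)K$ zero-one matrix copying each $\tau_{mk}$ into the two positions of its copies in $\mathbf{t}$, $\mathbf{E}_b$ is its block of rows corresponding to $\mathbf{t}_b$, and $\mathbf{E}^\dagger$ is its pseudo-inverse. The local constraints of base station $b$ are (SINR) for $k\in\mathcal{U}(b)$: $|\mathbf{h}_{bk}^H\mathbf{w}_k|^2\ge\gamma_k\big(\sum_{i\in\mathcal{U}(b)\setminus k}|\mathbf{h}_{bk}^H\mathbf{w}_i|^2+\sum_{m\ne b}(t_{mk}^{(b)})^2+\sigma_k^2\big)$; (INT) for $j\notin\mathcal{U}(b)$: $\big(\sum_{i\in\mathcal{U}(b)}|\mathbf{h}_{bj}^H\mathbf{w}_i|^2\big)^{1/2}\le t_{bj}^{(b)}$. The distributed problem is: minimize $\sum_k\|\mathbf{w}_k\|^2$ over $(\mathbf{W},\mathbf{t},\boldsymbol{\tau})$ subject to (SINR), (INT) for all $b$ and $\mathbf{E}\boldsymbol{\tau}=\mathbf{t}$. $\boldsymbol{\tau}^\star(\mathbf{H})$ is its optimal $\boldsymbol{\tau}$ and $\boldsymbol{\nu}^\star(\mathbf{H})$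 the optimal Lagrange multiplier of the constraint $\mathbf{E}\boldsymbol{\tau}=\mathbf{t}$ (entering the Lagrangian as $\boldsymbol{\nu}^T(\mathbf{t}-\mathbf{E}\boldsymbol{\tau})$), treated as unique. Dynamic ADMM algorithm with penalty $\rho>0$: initialize $\boldsymbol{\tau}^{[0]}$ and $\boldsymbol{\nu}^{[0]}\in\mathbb{R}^{2(B-1)K}$ (partitioned as $\mathbf{t}$) with $\mathbf{E}^T\boldsymbol{\nu}^{[0]}=\mathbf{0}$. For $i=1,2,\dots$: (1) for each $b$, let $(\{\mathbf{w}_k^{[i]}\}_{k\in\mathcal{U}(b)},\mathbf{t}_b^{[i]})$ be the minimizer of $\sum_{j\in\mathcal{U}(b)}\|\mathbf{w}_j\|^2+(\boldsymbol{\nu}_b^{[i-1]})^T(\mathbf{t}_b-\mathbf{E}_b\boldsymbol{\tau}^{[i-1]})+\frac{\rho}{2}\|\mathbf{t}_b-\mathbf{E}_b\boldsymbol{\tau}^{[i-1]}\|^2$ subject to (SINR) and (INT) for base station $b$ with channels $\mathbf{H}^{[i]}$; (2) $\boldsymbol{\tau}^{[i]}=\mathbf{E}^\dagger\mathbf{t}^{[i]}$; (3) $\boldsymbol{\nu}_b^{[i]}=\boldsymbol{\nu}_b^{[i-1]}+\rho(\mathbf{t}_b^{[i]}-\mathbf{E}_b\boldsymbol{\tau}^{[i]})$ for each $b$. Lyapunov function: $V(\boldsymbol{\nu},\boldsymbol{\tau},\mathbf{H})=\frac1\rho\|\boldsymbol{\nu}-\boldsymbol{\nu}^\star(\mathbf{H})\|^2+\rho\|\mathbf{E}(\boldsymbol{\tau}-\boldsymbol{\tau}^\star(\mathbf{H}))\|^2$.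 *)

theory Defs
  imports "HOL-Analysis.Analysis"
begin

text \<open>
  Base stations, users and antennas are indexed by arbitrary finite types \<open>'b\<close>, \<open>'k\<close>, \<open>'n\<close>, and
  \<open>bs k\<close> is the base station serving user \<open>k\<close>. For a collection of channels \<open>H\<close>, the vector
  \<open>H $ m $ k\<close> is the channel from base station \<open>m\<close> to user \<open>k\<close>; \<open>W $ k\<close> is the beam-former of
  user \<open>k\<close>.
\<close>

type_synonym ('n, 'k, 'b) channels = "complex ^ 'n ^ 'k ^ 'b"
type_synonym ('n, 'k) beams = "complex ^ 'n ^ 'k"

definition is_norm :: "('a::real_vector \<Rightarrow> real) \<Rightarrow> bool" where
  "is_norm f \<longleftrightarrow>
     (\<forall>x. f x = 0 \<longleftrightarrow> x = 0) \<and>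
     (\<forall>a x. f (a *\<^sub>R x) = \<bar>a\<bar> * f x) \<and>
     (\<forall>x y. f (x + y) \<le> f x + f y)"

definition hdot :: "complex ^ 'n \<Rightarrow> complex ^ 'n \<Rightarrow> complex" where
  "hdot h w = (\<Sum>n\<in>UNIV. cnj (h $ n) * w $ n)"

definition users :: "('k \<Rightarrow> 'b) \<Rightarrow> 'b \<Rightarrow> 'k set" where
  "users bs b = {k. bs k = b}"

definition SINR ::
  "('k::finite \<Rightarrow> 'b::finite) \<Rightarrow> ('k \<Rightarrow> real) \<Rightarrow> 'k \<Rightarrow> ('n::finite, 'k) beams
     \<Rightarrow> ('n, 'k, 'b) channels \<Rightarrow> real" where
  "SINR bs \<sigma> k W H =
     (cmod (hdot (H $ bs k $ k) (W $ k)))\<^sup>2 /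
     ((\<Sum>i\<in>users bs (bs k) - {k}. (cmod (hdot (H $ bs k $ k) (W $ i)))\<^sup>2)
      + (\<Sum>m\<in>UNIV - {bs k}. \<Sum>i\<in>users bs m. (cmod (hdot (H $ m $ k) (W $ i)))\<^sup>2)
      + (\<sigma> k)\<^sup>2)"

definition strictly_feasible ::
  "('k::finite \<Rightarrow> 'b::finite) \<Rightarrow> ('k \<Rightarrow> real) \<Rightarrow> ('k \<Rightarrow> real)
     \<Rightarrow> ('n::finite, 'k, 'b) channels \<Rightarrow> bool" where
  "strictly_feasible bs \<gamma> \<sigma> H \<longleftrightarrow> (\<exists>W. \<forall>k. SINR bs \<sigma> k W H > \<gamma> k)"

text \<open>
  The copy of the interference amplitude from base station \<open>m\<close> to user \<open>k\<close> that is held by base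
  station \<open>h\<close> is stored at index \<open>(h, m, k)\<close>; it exists only for \<open>m \<noteq> bs k\<close> and
  \<open>h = m \<or> h = bs k\<close>. Since these \<open>2 (B - 1) K\<close> index triples do not form a type, the space of
  vectors indexed by them is represented as the subspace of vectors that vanish at all other
  triples, with the induced inner product and norm. Likewise the consistency variables are
  indexed by the \<open>(B - 1) K\<close> pairs \<open>(m, k)\<close> with \<open>m \<noteq> bs k\<close>.
\<close>

type_synonym ('k, 'b) link_vec = "real ^ ('b \<times> 'k)"
type_synonym ('k, 'b) copy_vec = "real ^ ('b \<times> 'b \<times> 'k)"

definition links :: "('k \<Rightarrow> 'b) \<Rightarrow> ('b \<times> 'k) set" where
  "links bs = {(m, k). m \<noteq> bs k}"

definition copies :: "('k \<Rightarrow> 'b) \<Rightarrow> ('b \<times> 'b \<times> 'k) set" where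
  "copies bs = {(h, m, k). m \<noteq> bs k \<and> (h = m \<or> h = bs k)}"

definition link_space :: "('k::finite \<Rightarrow> 'b::finite) \<Rightarrow> ('k, 'b) link_vec set" where
  "link_space bs = {\<tau>. \<forall>l. l \<notin> links bs \<longrightarrow> \<tau> $ l = 0}"

definition copy_space :: "('k::finite \<Rightarrow> 'b::finite) \<Rightarrow> ('k, 'b) copy_vec set" where
  "copy_space bs = {t. \<forall>c. c \<notin> copies bs \<longrightarrow> t $ c = 0}"

text \<open>
  The matrix \<open>E\<close>, padded with zero rows and columns at the unused indices. The padding of the
  pseudo-inverse is the pseudo-inverse of the padding.
\<close>

definition copy_matrix ::
  "('k::finite \<Rightarrow> 'b::finite) \<Rightarrow> real ^ ('b \<times> 'k) ^ ('b \<times> 'b \<times> 'k)" where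
  "copy_matrix bs = (\<chi> c l. if c \<in> copies bs \<and> snd c = l then 1 else 0)"

definition is_pseudo_inverse ::
  "real ^ 'c::finite ^ 'r::finite \<Rightarrow> real ^ 'r ^ 'c \<Rightarrow> bool" where
  "is_pseudo_inverse A X \<longleftrightarrow>
     A ** X ** A = A \<and> X ** A ** X = X \<and>
     transpose (A ** X) = A ** X \<and> transpose (X ** A) = X ** A"

definition pseudo_inverse ::
  "real ^ 'c::finite ^ 'r::finite \<Rightarrow> real ^ 'r ^ 'c" where
  "pseudo_inverse A = (THE X. is_pseudo_inverse A X)"

text \<open>The block of a copy vector held by base station \<open>b\<close>, extended by zero.\<close>

definition block :: "'b \<Rightarrow> ('k::finite, 'b::finite) copy_vec \<Rightarrow> ('k, 'b) copy_vec" where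
  "block b t = (\<chi> c. if fst c = b then t $ c else 0)"

text \<open>
  The first conjunct is the phase convention, under which the SINR constraints are second-order
  cone constraints.
\<close>

definition local_constraints ::
  "('k::finite \<Rightarrow> 'b::finite) \<Rightarrow> ('k \<Rightarrow> real) \<Rightarrow> ('k \<Rightarrow> real) \<Rightarrow> ('n::finite, 'k, 'b) channels
     \<Rightarrow> 'b \<Rightarrow> ('n, 'k) beams \<Rightarrow> ('k, 'b) copy_vec \<Rightarrow> bool" where
  "local_constraints bs \<gamma> \<sigma> H b W t \<longleftrightarrow>
     (\<forall>k\<in>users bs b. hdot (H $ b $ k) (W $ k) \<in> \<real>\<^sub>\<ge>\<^sub>0) \<and>
     (\<forall>k\<in>users bs b.
        (cmod (hdot (H $ b $ k) (W $ k)))\<^sup>2 \<ge>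
        \<gamma> k * ((\<Sum>i\<in>users bs b - {k}. (cmod (hdot (H $ b $ k) (W $ i)))\<^sup>2)
               + (\<Sum>m\<in>UNIV - {b}. (t $ (b, m, k))\<^sup>2)
               + (\<sigma> k)\<^sup>2)) \<and>
     (\<forall>j. j \<notin> users bs b \<longrightarrow>
        sqrt (\<Sum>i\<in>users bs b. (cmod (hdot (H $ b $ j) (W $ i)))\<^sup>2) \<le> t $ (b, b, j))"

text \<open>The distributed problem, its optimal consistency variable and its optimal multiplier.\<close>

definition total_power :: "('n::finite, 'k::finite) beams \<Rightarrow> real" where
  "total_power W = (\<Sum>k\<in>UNIV. (norm (W $ k))\<^sup>2)"

definition locally_feasible ::
  "('k::finite \<Rightarrow> 'b::finite) \<Rightarrow> ('k \<Rightarrow> real) \<Rightarrow> ('k \<Rightarrow> real) \<Rightarrow> ('n::finite, 'k, 'b) channels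
     \<Rightarrow> ('n, 'k) beams \<times> ('k, 'b) copy_vec \<times> ('k, 'b) link_vec \<Rightarrow> bool" where
  "locally_feasible bs \<gamma> \<sigma> H = (\<lambda>(W, t, \<tau>).
     t \<in> copy_space bs \<and> \<tau> \<in> link_space bs \<and> (\<forall>b. local_constraints bs \<gamma> \<sigma> H b W t))"

definition distributed_optimal ::
  "('k::finite \<Rightarrow> 'b::finite) \<Rightarrow> ('k \<Rightarrow> real) \<Rightarrow> ('k \<Rightarrow> real) \<Rightarrow> ('n::finite, 'k, 'b) channels
     \<Rightarrow> ('n, 'k) beams \<times> ('k, 'b) copy_vec \<times> ('k, 'b) link_vec \<Rightarrow> bool" where
  "distributed_optimal bs \<gamma> \<sigma> H =
     is_arg_min (\<lambda>(W, t, \<tau>). total_power W)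
       (\<lambda>(W, t, \<tau>). locally_feasible bs \<gamma> \<sigma> H (W, t, \<tau>) \<and> copy_matrix bs *v \<tau> = t)"

definition lagrangian ::
  "('k::finite \<Rightarrow> 'b::finite) \<Rightarrow> ('k, 'b) copy_vec
     \<Rightarrow> ('n::finite, 'k) beams \<times> ('k, 'b) copy_vec \<times> ('k, 'b) link_vec \<Rightarrow> real" where
  "lagrangian bs \<nu> = (\<lambda>(W, t, \<tau>). total_power W + \<nu> \<bullet> (t - copy_matrix bs *v \<tau>))"

definition optimal_tau ::
  "('k::finite \<Rightarrow> 'b::finite) \<Rightarrow> ('k \<Rightarrow> real) \<Rightarrow> ('k \<Rightarrow> real) \<Rightarrow> ('n::finite, 'k, 'b) channels
     \<Rightarrow> ('k, 'b) link_vec \<Rightarrow> bool" where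
  "optimal_tau bs \<gamma> \<sigma> H \<tau> \<longleftrightarrow> (\<exists>W t. distributed_optimal bs \<gamma> \<sigma> H (W, t, \<tau>))"

text \<open>
  Only the constraint \<open>E \<tau> = t\<close> is dualized: \<open>\<nu>\<close> is an optimal multiplier if some primal
  optimum minimizes the Lagrangian over all points satisfying the local constraints. (On the
  primal optimum the Lagrangian equals the optimal value, whence \<open>\<nu>\<close> and that optimum form a
  saddle point.)
\<close>

definition optimal_multiplier ::
  "('k::finite \<Rightarrow> 'b::finite) \<Rightarrow> ('k \<Rightarrow> real) \<Rightarrow> ('k \<Rightarrow> real) \<Rightarrow> ('n::finite, 'k, 'b) channels
     \<Rightarrow> ('k, 'b) copy_vec \<Rightarrow> bool" where
  "optimal_multiplier bs \<gamma> \<sigma> H \<nu> \<longleftrightarrow>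
     \<nu> \<in> copy_space bs \<and>
     (\<exists>x. distributed_optimal bs \<gamma> \<sigma> H x \<and>
          is_arg_min (lagrangian bs \<nu>) (locally_feasible bs \<gamma> \<sigma> H) x)"

definition tau_star ::
  "('k::finite \<Rightarrow> 'b::finite) \<Rightarrow> ('k \<Rightarrow> real) \<Rightarrow> ('k \<Rightarrow> real) \<Rightarrow> ('n::finite, 'k, 'b) channels
     \<Rightarrow> ('k, 'b) link_vec" where
  "tau_star bs \<gamma> \<sigma> H = (THE \<tau>. optimal_tau bs \<gamma> \<sigma> H \<tau>)"

definition nu_star ::
  "('k::finite \<Rightarrow> 'b::finite) \<Rightarrow> ('k \<Rightarrow> real) \<Rightarrow> ('k \<Rightarrow> real) \<Rightarrow> ('n::finite, 'k, 'b) channels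
     \<Rightarrow> ('k, 'b) copy_vec" where
  "nu_star bs \<gamma> \<sigma> H = (THE \<nu>. optimal_multiplier bs \<gamma> \<sigma> H \<nu>)"

text \<open>
  The variables of the problem solved by base station \<open>b\<close> are its own beam-formers and its own
  block of copies, both extended by zero.
\<close>

definition admm_local_feasible ::
  "('k::finite \<Rightarrow> 'b::finite) \<Rightarrow> ('k \<Rightarrow> real) \<Rightarrow> ('k \<Rightarrow> real) \<Rightarrow> ('n::finite, 'k, 'b) channels
     \<Rightarrow> 'b \<Rightarrow> ('n, 'k) beams \<times> ('k, 'b) copy_vec \<Rightarrow> bool" where
  "admm_local_feasible bs \<gamma> \<sigma> H b = (\<lambda>(W, t).
     (\<forall>k. k \<notin> users bs b \<longrightarrow> W $ k = 0) \<and>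
     t \<in> copy_space bs \<and> block b t = t \<and>
     local_constraints bs \<gamma> \<sigma> H b W t)"

definition admm_local_objective ::
  "('k::finite \<Rightarrow> 'b::finite) \<Rightarrow> real \<Rightarrow> 'b \<Rightarrow> ('k, 'b) link_vec \<Rightarrow> ('k, 'b) copy_vec
     \<Rightarrow> ('n::finite, 'k) beams \<times> ('k, 'b) copy_vec \<Rightarrow> real" where
  "admm_local_objective bs \<rho> b \<tau> \<nu> = (\<lambda>(W, t).
     (\<Sum>j\<in>users bs b. (norm (W $ j))\<^sup>2)
     + block b \<nu> \<bullet> (t - block b (copy_matrix bs *v \<tau>))
     + \<rho> / 2 * (norm (t - block b (copy_matrix bs *v \<tau>)))\<^sup>2)"

definition admm_local_solution ::
  "('k::finite \<Rightarrow> 'b::finite) \<Rightarrow> ('k \<Rightarrow> real) \<Rightarrow> ('k \<Rightarrow> real) \<Rightarrow> real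
     \<Rightarrow> ('k, 'b) link_vec \<Rightarrow> ('k, 'b) copy_vec \<Rightarrow> ('n::finite, 'k, 'b) channels
     \<Rightarrow> 'b \<Rightarrow> ('n, 'k) beams \<times> ('k, 'b) copy_vec" where
  "admm_local_solution bs \<gamma> \<sigma> \<rho> \<tau> \<nu> H b =
     arg_min (admm_local_objective bs \<rho> b \<tau> \<nu>) (admm_local_feasible bs \<gamma> \<sigma> H b)"

definition admm_W ::
  "('k::finite \<Rightarrow> 'b::finite) \<Rightarrow> ('k \<Rightarrow> real) \<Rightarrow> ('k \<Rightarrow> real) \<Rightarrow> real
     \<Rightarrow> ('k, 'b) link_vec \<Rightarrow> ('k, 'b) copy_vec \<Rightarrow> ('n::finite, 'k, 'b) channels
     \<Rightarrow> ('n, 'k) beams" where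
  "admm_W bs \<gamma> \<sigma> \<rho> \<tau> \<nu> H = (\<chi> k. fst (admm_local_solution bs \<gamma> \<sigma> \<rho> \<tau> \<nu> H (bs k)) $ k)"

definition admm_t ::
  "('k::finite \<Rightarrow> 'b::finite) \<Rightarrow> ('k \<Rightarrow> real) \<Rightarrow> ('k \<Rightarrow> real) \<Rightarrow> real
     \<Rightarrow> ('k, 'b) link_vec \<Rightarrow> ('k, 'b) copy_vec \<Rightarrow> ('n::finite, 'k, 'b) channels
     \<Rightarrow> ('k, 'b) copy_vec" where
  "admm_t bs \<gamma> \<sigma> \<rho> \<tau> \<nu> H = (\<chi> c. snd (admm_local_solution bs \<gamma> \<sigma> \<rho> \<tau> \<nu> H (fst c)) $ c)"

definition admm_tau ::
  "('k::finite \<Rightarrow> 'b::finite) \<Rightarrow> ('k \<Rightarrow> real) \<Rightarrow> ('k \<Rightarrow> real) \<Rightarrow> real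
     \<Rightarrow> ('k, 'b) link_vec \<Rightarrow> ('k, 'b) copy_vec \<Rightarrow> ('n::finite, 'k, 'b) channels
     \<Rightarrow> ('k, 'b) link_vec" where
  "admm_tau bs \<gamma> \<sigma> \<rho> \<tau> \<nu> H = pseudo_inverse (copy_matrix bs) *v admm_t bs \<gamma> \<sigma> \<rho> \<tau> \<nu> H"

text \<open>The blockwise dual updates of all base stations, written as one vector equation.\<close>

definition admm_nu ::
  "('k::finite \<Rightarrow> 'b::finite) \<Rightarrow> ('k \<Rightarrow> real) \<Rightarrow> ('k \<Rightarrow> real) \<Rightarrow> real
     \<Rightarrow> ('k, 'b) link_vec \<Rightarrow> ('k, 'b) copy_vec \<Rightarrow> ('n::finite, 'k, 'b) channels
     \<Rightarrow> ('k, 'b) copy_vec" where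
  "admm_nu bs \<gamma> \<sigma> \<rho> \<tau> \<nu> H =
     \<nu> + \<rho> *\<^sub>R (admm_t bs \<gamma> \<sigma> \<rho> \<tau> \<nu> H - copy_matrix bs *v admm_tau bs \<gamma> \<sigma> \<rho> \<tau> \<nu> H)"

primrec dynamic_admm ::
  "('k::finite \<Rightarrow> 'b::finite) \<Rightarrow> ('k \<Rightarrow> real) \<Rightarrow> ('k \<Rightarrow> real) \<Rightarrow> real
     \<Rightarrow> ('k, 'b) link_vec \<Rightarrow> ('k, 'b) copy_vec \<Rightarrow> (nat \<Rightarrow> ('n::finite, 'k, 'b) channels)
     \<Rightarrow> nat \<Rightarrow> ('k, 'b) link_vec \<times> ('k, 'b) copy_vec" where
  "dynamic_admm bs \<gamma> \<sigma> \<rho> \<tau>0 \<nu>0 H 0 = (\<tau>0, \<nu>0)"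
| "dynamic_admm bs \<gamma> \<sigma> \<rho> \<tau>0 \<nu>0 H (Suc i) =
     (let (\<tau>, \<nu>) = dynamic_admm bs \<gamma> \<sigma> \<rho> \<tau>0 \<nu>0 H i
      in (admm_tau bs \<gamma> \<sigma> \<rho> \<tau> \<nu> (H (Suc i)), admm_nu bs \<gamma> \<sigma> \<rho> \<tau> \<nu> (H (Suc i))))"

definition lyapunov ::
  "('k::finite \<Rightarrow> 'b::finite) \<Rightarrow> ('k \<Rightarrow> real) \<Rightarrow> ('k \<Rightarrow> real) \<Rightarrow> real
     \<Rightarrow> ('k, 'b) copy_vec \<Rightarrow> ('k, 'b) link_vec \<Rightarrow> ('n::finite, 'k, 'b) channels \<Rightarrow> real" where
  "lyapunov bs \<gamma> \<sigma> \<rho> \<nu> \<tau> H =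
     1 / \<rho> * (norm (\<nu> - nu_star bs \<gamma> \<sigma> H))\<^sup>2
     + \<rho> * (norm (copy_matrix bs *v (\<tau> - tau_star bs \<gamma> \<sigma> H)))\<^sup>2"

end

theory Submission
  imports Defs
begin

text \<open>
  For fixed channels, the algorithm is the alternating direction method of multipliers for a convex
  problem, and the Lyapunov function is the squared distance of \<open>(\<nu>, E \<tau>)\<close> from its optimum,
  with the two parts weighted by \<open>1 / \<rho>\<close> and \<open>\<rho>\<close>. The phase convention makes the local
  constraints second-order cone constraints, so the set of admissible beam-formers and copies is
  convex. The local problems together minimize the augmented Lagrangian over this set, and by
  convexity the new iterate then minimizes an ordinary Lagrangian as well. Combined with the saddle
  point property of the optimum, this shows that one iteration decreases the Lyapunov function by
  at least the squared length of the step (\<open>lyapunov_descent\<close>). A step of length zero is possible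
  only at the optimum (\<open>lyapunov_decrease_zero\<close>): there the residual vanishes, so the iterate is
  feasible and minimizes the Lagrangian, and the optima are unique.

  For varying channels, each iteration first gains this decrease and then suffers from the motion
  of the optimum. The states with a bounded Lyapunov value form a bounded set, uniformly over the
  compact set of channels. On the compact part where the value is also at least \<open>c / 2\<close>, the
  continuous decrease is bounded away from zero, whereas the loss caused by the channel variation
  is uniformly small with that variation. So sufficiently slow channels let the value fall until it
  is at most \<open>c\<close>, and keep it there. This compactness argument does not depend on the
  particular algorithm and is carried out in \<open>lyapunov_tracking\<close>.
\<close>


section \<open>Lyapunov functions under slowly drifting parameters\<close>

text \<open>
  The sequence may jump upwards once it is below the threshold \<open>a\<close>, but only to a value at most
  \<open>c\<close>. Above \<open>a\<close> it loses the fixed amount \<open>\<eta>\<close> per step, which cannot go on forever, and from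
  the first value at most \<open>c\<close> on it can never exceed \<open>c\<close> again.
\<close>

lemma eventually_le_of_decrease:
  fixes v :: "nat \<Rightarrow> real"
  assumes start: "v 0 \<le> M" and "c \<le> M" and "\<eta> > 0"
    and high: "\<And>i. v i \<le> M \<Longrightarrow> v i \<ge> a \<Longrightarrow> v (Suc i) \<le> v i - \<eta>"
    and low: "\<And>i. v i \<le> M \<Longrightarrow> v i < a \<Longrightarrow> v (Suc i) \<le> c"
    and "a \<le> c"
  shows "\<forall>\<^sub>F i in sequentially. v i \<le> c"
proof -
  have bounded: "v i \<le> M" for i
  proof (induction i)
    case (Suc i)
    show ?case
    proof (cases "v i < a")
      case True
      then show ?thesis using low[OF Suc.IH] \<open>c \<le> M\<close> by linarith
    next
      case False
      then show ?thesis using high[OF Suc.IH] Suc.IH \<open>\<eta> > 0\<close> by linarith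
    qed
  qed (rule start)
  have "\<exists>n. v n \<le> c"
  proof (rule ccontr)
    assume "\<nexists>n. v n \<le> c"
    then have above: "v n > c" for n by (auto simp: not_le)
    have "v n \<le> M - real n * \<eta>" for n
    proof (induction n)
      case (Suc n)
      then show ?case using high[of n] bounded[of n] above[of n] \<open>a \<le> c\<close> by (simp add: algebra_simps)
    qed (simp add: start)
    moreover obtain n where "real n * \<eta> > M - c"
      using reals_Archimedean3[OF \<open>\<eta> > 0\<close>] by auto
    ultimately show False using above[of n] by (smt (verit))
  qed
  then obtain n where n: "v n \<le> c" ..
  have "v i \<le> c" if "i \<ge> n" for i
    using that
  proof (induction i rule: dec_induct)
    case (step i)
    show ?case
    proof (cases "v i < a")
      case False
      then show ?thesis using high[OF bounded] step.IH \<open>\<eta> > 0\<close> by (simp add: not_less) (smt (verit))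
    qed (rule low[OF bounded])
  qed (rule n)
  then show ?thesis by (auto simp: eventually_sequentially)
qed

text \<open>
  The general principle behind the result. Every step with parameter \<open>h\<close> decreases \<open>V _ h\<close> by at
  least \<open>D _ h\<close>, and the parameter then moves a little, which may increase \<open>V\<close> again. As long as
  \<open>V\<close> stays below a fixed level \<open>M\<close>, the state stays in a compact set. There \<open>D\<close> has a positive
  lower bound \<open>\<epsilon>\<close> wherever \<open>V \<ge> c / 2\<close>, because \<open>D\<close> vanishes only where \<open>V\<close> does, and
  \<open>V\<close> is uniformly continuous there, so for small parameter drift it regains at most \<open>\<epsilon> / 2\<close>.
\<close>

theorem lyapunov_tracking:
  fixes V D :: "'z::heine_borel \<Rightarrow> 'h::metric_space \<Rightarrow> real" and step :: "'z \<Rightarrow> 'h \<Rightarrow> 'z"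
  assumes "closed A" and "compact P" and "z0 \<in> A" and "c > 0"
    and V_cont: "continuous_on (A \<times> P) (\<lambda>(z, h). V z h)"
    and D_cont: "continuous_on (A \<times> P) (\<lambda>(z, h). D z h)"
    and coercive: "\<And>M. bounded {z \<in> A. \<exists>h\<in>P. V z h \<le> M}"
    and step: "\<And>z h. z \<in> A \<Longrightarrow> h \<in> P \<Longrightarrow> step z h \<in> A"
    and descent: "\<And>z h. z \<in> A \<Longrightarrow> h \<in> P \<Longrightarrow> V (step z h) h + D z h \<le> V z h"
    and D_nonneg: "\<And>z h. z \<in> A \<Longrightarrow> h \<in> P \<Longrightarrow> D z h \<ge> 0"
    and D_zero: "\<And>z h. z \<in> A \<Longrightarrow> h \<in> P \<Longrightarrow> D z h = 0 \<Longrightarrow> V z h = 0"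
  shows "\<exists>d>0. \<forall>z h. z 0 = z0 \<longrightarrow> (\<forall>i. z (Suc i) = step (z i) (h (Suc i))) \<longrightarrow> (\<forall>i. h i \<in> P) \<longrightarrow>
           (\<forall>i. dist (h (Suc i)) (h i) < d) \<longrightarrow> (\<forall>\<^sub>F i in sequentially. V (z i) (h (Suc i)) \<le> c)"
proof -
  have "continuous_on P (\<lambda>h. V z0 h)"
  proof -
    have "continuous_on P (\<lambda>h. (z0, h))" by (intro continuous_intros)
    moreover have "(\<lambda>h. (z0, h)) ` P \<subseteq> A \<times> P" using \<open>z0 \<in> A\<close> by blast
    ultimately show ?thesis
      using continuous_on_compose2[OF V_cont] by fastforce
  qed
  then have "bdd_above ((\<lambda>h. V z0 h) ` P)"
    by (intro bounded_imp_bdd_above compact_imp_bounded compact_continuous_image \<open>compact P\<close>)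
  then obtain M0 where M0: "\<And>h. h \<in> P \<Longrightarrow> V z0 h \<le> M0"
    unfolding bdd_above_def by blast
  \<comment> \<open>\<open>M\<close> bounds \<open>V\<close> along the whole run: at the start by the choice of \<open>M0\<close>, whatever the
    first parameter is, and after a visit to the region \<open>V < c / 2\<close> because it is at least \<open>c\<close>.\<close>
  define M where "M = max M0 c"
  obtain R where R: "\<And>z h. z \<in> A \<Longrightarrow> h \<in> P \<Longrightarrow> V z h \<le> M \<Longrightarrow> z \<in> cball z0 R"
    using coercive[of M] unfolding bounded_any_center[where a = z0] by (auto simp: dist_commute)
  define S where "S = (A \<inter> cball z0 R) \<times> P"
  have "compact S"
    unfolding S_def using \<open>closed A\<close> \<open>compact P\<close>
    by (intro compact_Times closed_Int_compact compact_cball)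
  have "S \<subseteq> A \<times> P" by (auto simp: S_def)
  note V_cont_S = continuous_on_subset[OF V_cont \<open>S \<subseteq> A \<times> P\<close>]
  define K where "K = S \<inter> (\<lambda>(z, h). V z h) -` {c / 2..M}"
  have "compact K"
  proof -
    have "closed K"
      unfolding K_def using V_cont_S compact_imp_closed[OF \<open>compact S\<close>]
      by (intro continuous_closed_preimage closed_atLeastAtMost)
    moreover have "K = S \<inter> K" by (auto simp: K_def)
    ultimately show ?thesis by (metis compact_Int_closed \<open>compact S\<close>)
  qed
  have "\<exists>\<epsilon>>0. \<forall>(z, h)\<in>K. \<epsilon> \<le> D z h"
  proof (cases "K = {}")
    case True
    then show ?thesis by (intro exI[of _ 1]) simp
  next
    case False
    have "continuous_on K (\<lambda>(z, h). D z h)"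
      by (rule continuous_on_subset[OF D_cont]) (auto simp: K_def S_def)
    then obtain p where p: "p \<in> K" "\<And>q. q \<in> K \<Longrightarrow> (\<lambda>(z, h). D z h) p \<le> (\<lambda>(z, h). D z h) q"
      using continuous_attains_inf[OF \<open>compact K\<close> False] by metis
    obtain z h where zh: "p = (z, h)" by fastforce
    have "z \<in> A" "h \<in> P" "V z h \<ge> c / 2"
      using p(1) by (auto simp: zh K_def S_def)
    then have "D z h > 0"
      using D_nonneg[of z h] D_zero[of z h] \<open>c > 0\<close> by linarith
    then show ?thesis using p(2) by (intro exI[of _ "D z h"]) (auto simp: zh)
  qed
  then obtain \<epsilon> where "\<epsilon> > 0" and \<epsilon>: "\<And>z h. (z, h) \<in> K \<Longrightarrow> \<epsilon> \<le> D z h" by auto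
  \<comment> \<open>A drift of \<open>\<epsilon> / 2\<close> leaves a net decrease of \<open>\<epsilon> / 2\<close> while \<open>V \<ge> c / 2\<close>; a drift of
    \<open>c / 2\<close> cannot lift a value below \<open>c / 2\<close> above \<open>c\<close>.\<close>
  define \<eta> where "\<eta> = min (\<epsilon> / 2) (c / 2)"
  have \<eta>: "\<eta> > 0" "\<eta> \<le> \<epsilon> / 2" "\<eta> \<le> c / 2" using \<open>\<epsilon> > 0\<close> \<open>c > 0\<close> by (auto simp: \<eta>_def)
  have "uniformly_continuous_on S (\<lambda>(z, h). V z h)"
    using V_cont_S \<open>compact S\<close> by (rule compact_uniformly_continuous)
  then obtain d where "d > 0" and d:
    "\<And>p q. p \<in> S \<Longrightarrow> q \<in> S \<Longrightarrow> dist p q < d \<Longrightarrow> dist ((\<lambda>(z, h). V z h) p) ((\<lambda>(z, h). V z h) q) < \<eta>"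
    using \<eta>(1) unfolding uniformly_continuous_on_def by metis
  show ?thesis
  proof (intro exI[of _ d] conjI allI impI)
    show "d > 0" by fact
    fix z :: "nat \<Rightarrow> 'z" and h :: "nat \<Rightarrow> 'h"
    assume z0: "z 0 = z0" and "\<forall>i. z (Suc i) = step (z i) (h (Suc i))"
      and "\<forall>i. h i \<in> P" and "\<forall>i. dist (h (Suc i)) (h i) < d"
    then have z_Suc: "z (Suc i) = step (z i) (h (Suc i))" and h: "h i \<in> P"
      and near: "dist (h (Suc i)) (h i) < d" for i by blast+
    define v where "v i = V (z i) (h (Suc i))" for i
    have zA: "z i \<in> A" for i
      by (induction i) (simp_all add: z0 z_Suc \<open>z0 \<in> A\<close> step h)
    have v_Suc: "v (Suc i) \<le> v i - D (z i) (h (Suc i)) + \<eta>" if "v i \<le> M" for i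
    proof -
      \<comment> \<open>The new state is already in the compact set for the old parameter, so uniform continuity
        covers the change to the new one.\<close>
      have desc: "V (z (Suc i)) (h (Suc i)) + D (z i) (h (Suc i)) \<le> v i"
        unfolding z_Suc v_def by (rule descent[OF zA h])
      then have "V (z (Suc i)) (h (Suc i)) \<le> M"
        using that D_nonneg[OF zA h, of i "Suc i"] by linarith
      then have "z (Suc i) \<in> cball z0 R"
        by (rule R[OF zA h])
      then have "(z (Suc i), h (Suc i)) \<in> S" "(z (Suc i), h (Suc (Suc i))) \<in> S"
        using zA h by (auto simp: S_def)
      then have "dist (V (z (Suc i)) (h (Suc (Suc i)))) (V (z (Suc i)) (h (Suc i))) < \<eta>"
        using d[of "(z (Suc i), h (Suc (Suc i)))" "(z (Suc i), h (Suc i))"] near[of "Suc i"]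
        by (simp add: dist_Pair_Pair)
      then show ?thesis
        using desc by (simp add: v_def dist_real_def)
    qed
    have "\<forall>\<^sub>F i in sequentially. v i \<le> c"
    proof (rule eventually_le_of_decrease[of v M c \<eta> "c / 2"])
      show "v 0 \<le> M" using M0[OF h, of 1] by (simp add: v_def z0 M_def)
      show "v (Suc i) \<le> v i - \<eta>" if "v i \<le> M" "c / 2 \<le> v i" for i
      proof -
        have "(z i, h (Suc i)) \<in> K"
          using that R[OF zA h, of i "Suc i"] zA h by (auto simp: K_def S_def v_def)
        then show ?thesis using \<epsilon> v_Suc[OF that(1)] \<eta>(2) by fastforce
      qed
      show "v (Suc i) \<le> c" if "v i \<le> M" "v i < c / 2" for i
        using v_Suc[OF that(1)] that(2) D_nonneg[OF zA h, of i "Suc i"] \<eta>(3) by linarith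
    qed (use \<eta> \<open>c > 0\<close> in \<open>auto simp: M_def\<close>)
    then show "\<forall>\<^sub>F i in sequentially. V (z i) (h (Suc i)) \<le> c" by (simp add: v_def)
  qed
qed

section \<open>The local constraints as second-order cone constraints\<close>

definition admissible_set ::
  "('k::finite \<Rightarrow> 'b::finite) \<Rightarrow> ('k \<Rightarrow> real) \<Rightarrow> ('k \<Rightarrow> real) \<Rightarrow> ('n::finite, 'k, 'b) channels
     \<Rightarrow> (('n, 'k) beams \<times> ('k, 'b) copy_vec) set" where
  "admissible_set bs \<gamma> \<sigma> H =
     {(W, t). t \<in> copy_space bs \<and> (\<forall>b. local_constraints bs \<gamma> \<sigma> H b W t)}"

text \<open>
  All terms that compete with the signal of user \<open>k\<close> (interference from the own cell, copies of the
  interference amplitudes from the other cells, noise) as components of one vector, whose squared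
  norm is the denominator of the local SINR. It is affine in the variables; only its noise
  component is constant.
\<close>

definition interference_vec ::
  "('k::finite \<Rightarrow> 'b::finite) \<Rightarrow> ('k \<Rightarrow> real) \<Rightarrow> ('n::finite, 'k, 'b) channels \<Rightarrow> 'b \<Rightarrow> 'k
     \<Rightarrow> ('n, 'k) beams \<times> ('k, 'b) copy_vec \<Rightarrow> (complex ^ 'k) \<times> (real ^ 'b) \<times> real" where
  "interference_vec bs \<sigma> H b k x =
     ((\<chi> i. if i \<in> users bs b - {k} then hdot (H $ b $ k) (fst x $ i) else 0),
      (\<chi> m. if m \<noteq> b then snd x $ (b, m, k) else 0), \<sigma> k)"

definition leakage_vec ::
  "('k::finite \<Rightarrow> 'b::finite) \<Rightarrow> ('n::finite, 'k, 'b) channels \<Rightarrow> 'b \<Rightarrow> 'k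
     \<Rightarrow> ('n, 'k) beams \<times> ('k, 'b) copy_vec \<Rightarrow> complex ^ 'k" where
  "leakage_vec bs H b j x = (\<chi> i. if i \<in> users bs b then hdot (H $ b $ j) (fst x $ i) else 0)"

lemma hdot_scaleR_add: "hdot h (a *\<^sub>R x + c *\<^sub>R y) = a *\<^sub>R hdot h x + c *\<^sub>R hdot h y"
  by (simp add: hdot_def sum.distrib scaleR_sum_right algebra_simps)

lemma continuous_on_hdot: "continuous_on S g \<Longrightarrow> continuous_on S (\<lambda>x. hdot h (g x))"
  unfolding hdot_def by (intro continuous_intros)

lemma norm_vec_if_squared:
  fixes g :: "'i::finite \<Rightarrow> 'a::real_normed_vector"
  shows "(norm (\<chi> i. if i \<in> A then g i else 0))\<^sup>2 = (\<Sum>i\<in>A. (norm (g i))\<^sup>2)"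
proof -
  have "(norm (\<chi> i. if i \<in> A then g i else 0))\<^sup>2
        = (\<Sum>i\<in>UNIV. (norm (if i \<in> A then g i else 0))\<^sup>2)"
    by (simp add: norm_vec_def L2_set_def sum_nonneg)
  also have "\<dots> = (\<Sum>i\<in>A. (norm (g i))\<^sup>2)"
    by (rule sum.mono_neutral_cong_right) auto
  finally show ?thesis .
qed

lemma norm_interference_vec_squared:
  "(norm (interference_vec bs \<sigma> H b k (W, t)))\<^sup>2 =
     (\<Sum>i\<in>users bs b - {k}. (cmod (hdot (H $ b $ k) (W $ i)))\<^sup>2)
     + (\<Sum>m\<in>UNIV - {b}. (t $ (b, m, k))\<^sup>2) + (\<sigma> k)\<^sup>2"
proof -
  have 1: "(norm (\<chi> m. if m \<noteq> b then t $ (b, m, k) else 0))\<^sup>2 = (\<Sum>m\<in>UNIV - {b}. (t $ (b, m, k))\<^sup>2)"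
    using norm_vec_if_squared[of "UNIV - {b}" "\<lambda>m. t $ (b, m, k)"] by simp
  have pair: "(norm (y, z))\<^sup>2 = (norm y)\<^sup>2 + (norm z)\<^sup>2"
    for y :: "'y::real_normed_vector" and z :: "'z::real_normed_vector"
    by (simp add: norm_Pair)
  show ?thesis
    using norm_vec_if_squared[of "users bs b - {k}" "\<lambda>i. hdot (H $ b $ k) (W $ i)"] 1
    unfolding interference_vec_def fst_conv snd_conv pair by simp
qed

text \<open>
  The SINR constraint compares two squares and is not convex by itself. The phase convention makes
  the received amplitude a nonnegative real number, so that roots can be taken on both sides, and
  the modulus on the right becomes a linear function of the beam-former.
\<close>

lemma local_constraints_iff_cone:
  assumes gamma_pos: "\<And>k. \<gamma> k > 0"
  shows "local_constraints bs \<gamma> \<sigma> H b W t \<longleftrightarrow>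
     (\<forall>k\<in>users bs b. hdot (H $ b $ k) (W $ k) \<in> \<real>\<^sub>\<ge>\<^sub>0) \<and>
     (\<forall>k\<in>users bs b. norm (sqrt (\<gamma> k) *\<^sub>R interference_vec bs \<sigma> H b k (W, t))
                       \<le> Re (hdot (H $ b $ k) (W $ k))) \<and>
     (\<forall>j. j \<notin> users bs b \<longrightarrow> norm (leakage_vec bs H b j (W, t)) \<le> t $ (b, b, j))"
proof -
  have sinr: "(cmod (hdot (H $ b $ k) (W $ k)))\<^sup>2 \<ge>
        \<gamma> k * ((\<Sum>i\<in>users bs b - {k}. (cmod (hdot (H $ b $ k) (W $ i)))\<^sup>2)
               + (\<Sum>m\<in>UNIV - {b}. (t $ (b, m, k))\<^sup>2) + (\<sigma> k)\<^sup>2) \<longleftrightarrow>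
       norm (sqrt (\<gamma> k) *\<^sub>R interference_vec bs \<sigma> H b k (W, t)) \<le> Re (hdot (H $ b $ k) (W $ k))"
    if real_gain: "hdot (H $ b $ k) (W $ k) \<in> \<real>\<^sub>\<ge>\<^sub>0" for k
  proof -
    let ?u = "norm (sqrt (\<gamma> k) *\<^sub>R interference_vec bs \<sigma> H b k (W, t))"
    have u: "?u\<^sup>2 = \<gamma> k * (norm (interference_vec bs \<sigma> H b k (W, t)))\<^sup>2"
      using gamma_pos[of k] by (simp add: power_mult_distrib)
    obtain r where r: "hdot (H $ b $ k) (W $ k) = complex_of_real r" "r \<ge> 0"
      using real_gain by (auto elim: nonneg_Reals_cases)
    then have "?u\<^sup>2 \<le> (cmod (hdot (H $ b $ k) (W $ k)))\<^sup>2 \<longleftrightarrow> ?u \<le> r"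
      by (simp add: abs_le_square_iff[symmetric])
    then show ?thesis
      using r by (simp only: u norm_interference_vec_squared Re_complex_of_real)
  qed
  have int: "sqrt (\<Sum>i\<in>users bs b. (cmod (hdot (H $ b $ j) (W $ i)))\<^sup>2)
             = norm (leakage_vec bs H b j (W, t))" for j
  proof -
    have "(norm (leakage_vec bs H b j (W, t)))\<^sup>2
          = (\<Sum>i\<in>users bs b. (cmod (hdot (H $ b $ j) (W $ i)))\<^sup>2)"
      using norm_vec_if_squared[of "users bs b" "\<lambda>i. hdot (H $ b $ j) (W $ i)"]
      unfolding leakage_vec_def fst_conv by simp
    then show ?thesis by (metis norm_ge_zero real_sqrt_unique)
  qed
  show ?thesis
    unfolding local_constraints_def int using sinr by blast
qed

lemma convex_norm_le:
  fixes F :: "'a::real_vector \<Rightarrow> 'c::real_normed_vector"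
  assumes F: "\<And>u x y. F ((1 - u) *\<^sub>R x + u *\<^sub>R y) = (1 - u) *\<^sub>R F x + u *\<^sub>R F y"
    and G: "\<And>u x y. G ((1 - u) *\<^sub>R x + u *\<^sub>R y) = (1 - u) * G x + u * G y"
  shows "convex {x. norm (F x) \<le> G x}"
  unfolding convex_alt
proof (intro ballI allI impI)
  fix x y and u :: real
  assume x: "x \<in> {x. norm (F x) \<le> G x}" and y: "y \<in> {x. norm (F x) \<le> G x}"
    and u: "0 \<le> u \<and> u \<le> 1"
  have "norm ((1 - u) *\<^sub>R F x + u *\<^sub>R F y) \<le> norm ((1 - u) *\<^sub>R F x) + norm (u *\<^sub>R F y)"
    by (rule norm_triangle_ineq)
  also have "\<dots> \<le> (1 - u) * G x + u * G y"
    using x y u by (auto intro!: add_mono mult_left_mono)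
  finally show "(1 - u) *\<^sub>R x + u *\<^sub>R y \<in> {x. norm (F x) \<le> G x}"
    by (simp add: F G)
qed

lemma interference_vec_affine:
  "interference_vec bs \<sigma> H b k ((1 - u) *\<^sub>R x + u *\<^sub>R y)
   = (1 - u) *\<^sub>R interference_vec bs \<sigma> H b k x + u *\<^sub>R interference_vec bs \<sigma> H b k y"
  by (simp add: interference_vec_def vec_eq_iff hdot_scaleR_add) (simp add: algebra_simps)

lemma leakage_vec_affine:
  "leakage_vec bs H b j ((1 - u) *\<^sub>R x + u *\<^sub>R y)
   = (1 - u) *\<^sub>R leakage_vec bs H b j x + u *\<^sub>R leakage_vec bs H b j y"
  by (simp add: leakage_vec_def vec_eq_iff hdot_scaleR_add)

text \<open>The condition selects components of a vector and does not depend on the argument.\<close>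

lemma continuous_on_constant_if:
  assumes "P \<Longrightarrow> continuous_on S f" and "\<not> P \<Longrightarrow> continuous_on S g"
  shows "continuous_on S (\<lambda>x. if P then f x else g x)"
  using assms by (cases P) simp_all

lemma continuous_on_interference_vec: "continuous_on S (interference_vec bs \<sigma> H b k)"
  unfolding interference_vec_def
  by (intro continuous_intros continuous_on_vec_lambda continuous_on_constant_if continuous_on_hdot)

lemma continuous_on_leakage_vec: "continuous_on S (leakage_vec bs H b j)"
  unfolding leakage_vec_def
  by (intro continuous_intros continuous_on_vec_lambda continuous_on_constant_if continuous_on_hdot)

lemma local_constraints_closed_convex:
  assumes gamma_pos: "\<And>k. \<gamma> k > 0"
  shows "closed {(W, t). local_constraints bs \<gamma> \<sigma> H b W t}"
    and "convex {(W, t). local_constraints bs \<gamma> \<sigma> H b W t}"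
proof -
  let ?phase = "\<lambda>k. {x. hdot (H $ b $ k) (fst x $ k) \<in> \<real>\<^sub>\<ge>\<^sub>0}"
  let ?sinr = "\<lambda>k. {x. norm (sqrt (\<gamma> k) *\<^sub>R interference_vec bs \<sigma> H b k x)
                        \<le> Re (hdot (H $ b $ k) (fst x $ k))}"
  let ?int = "\<lambda>j. {x. norm (leakage_vec bs H b j x) \<le> snd x $ (b, b, j)}"
  have eq: "{(W, t). local_constraints bs \<gamma> \<sigma> H b W t} =
        (\<Inter>k\<in>users bs b. ?phase k) \<inter> (\<Inter>k\<in>users bs b. ?sinr k) \<inter> (\<Inter>j\<in>- users bs b. ?int j)"
  proof (rule set_eqI)
    fix x
    show "x \<in> {(W, t). local_constraints bs \<gamma> \<sigma> H b W t} \<longleftrightarrow>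
        x \<in> (\<Inter>k\<in>users bs b. ?phase k) \<inter> (\<Inter>k\<in>users bs b. ?sinr k) \<inter> (\<Inter>j\<in>- users bs b. ?int j)"
      by (cases x, simp add: local_constraints_iff_cone[of \<gamma>, OF gamma_pos] del: norm_scaleR, blast)
  qed
  have "closed (?phase k)" for k
    using closed_vimage[OF closed_nonneg_Reals_complex, of "\<lambda>x. hdot (H $ b $ k) (fst x $ k)"]
    by (simp add: vimage_def continuous_on_hdot continuous_on_component continuous_on_fst)
  moreover have "closed (?sinr k)" for k
    by (intro closed_Collect_le continuous_intros continuous_on_interference_vec continuous_on_hdot)
  moreover have "closed (?int j)" for j
    by (intro closed_Collect_le continuous_intros continuous_on_leakage_vec)
  ultimately show "closed {(W, t). local_constraints bs \<gamma> \<sigma> H b W t}"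
    unfolding eq by (intro closed_Int closed_INT ballI)
  have "convex (?phase k)" for k
    unfolding convex_alt
    by (auto simp: hdot_scaleR_add complex_nonneg_Reals_iff)
  moreover have "convex (?sinr k)" for k
    by (rule convex_norm_le)
      (simp_all add: interference_vec_affine hdot_scaleR_add scaleR_right_distrib mult.commute)
  moreover have "convex (?int j)" for j
    by (rule convex_norm_le) (simp_all add: leakage_vec_affine)
  ultimately show "convex {(W, t). local_constraints bs \<gamma> \<sigma> H b W t}"
    unfolding eq by (intro convex_Int convex_INT)
qed

lemma subspace_copy_space: "subspace (copy_space bs)"
  by (auto simp: subspace_def copy_space_def)

lemma subspace_link_space: "subspace (link_space bs)"
  by (auto simp: subspace_def link_space_def)

text \<open>
  Convexity is what turns minimizers of the augmented Lagrangian into minimizers of a linearized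
  one, and thereby stationary points of the algorithm into optimal ones.
\<close>

lemma convex_admissible_set:
  assumes gamma_pos: "\<And>k. \<gamma> k > 0"
  shows "convex (admissible_set bs \<gamma> \<sigma> H)"
proof -
  have "admissible_set bs \<gamma> \<sigma> H =
        (UNIV \<times> copy_space bs) \<inter> (\<Inter>b. {(W, t). local_constraints bs \<gamma> \<sigma> H b W t})"
    by (auto simp: admissible_set_def)
  also have "convex \<dots>"
    by (intro convex_Int convex_Times convex_UNIV convex_INT subspace_imp_convex
        subspace_copy_space local_constraints_closed_convex(2) gamma_pos)
  finally show ?thesis .
qed

section \<open>One iteration minimizes the augmented Lagrangian\<close>

text \<open>The constraints of one base station see only its own beam-formers and its own block of copies.\<close>

lemma local_constraints_cong:
  assumes "\<And>k. k \<in> users bs b \<Longrightarrow> W $ k = W' $ k"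
    and "\<And>m k. t $ (b, m, k) = t' $ (b, m, k)"
  shows "local_constraints bs \<gamma> \<sigma> H b W t \<longleftrightarrow> local_constraints bs \<gamma> \<sigma> H b W' t'"
  using assms by (simp add: local_constraints_def)

lemma inner_block_sum:
  "(\<Sum>b\<in>UNIV. block b s \<bullet> block b t) = s \<bullet> t"
proof -
  have "block b s \<bullet> block b t = (\<Sum>c\<in>UNIV. if fst c = b then s $ c * t $ c else 0)" for b
    by (simp add: inner_vec_def block_def if_distrib cong: if_cong)
  then have "(\<Sum>b\<in>UNIV. block b s \<bullet> block b t)
             = (\<Sum>b\<in>UNIV. \<Sum>c\<in>UNIV. if fst c = b then s $ c * t $ c else 0)"
    by simp
  also have "\<dots> = (\<Sum>c\<in>UNIV. \<Sum>b\<in>UNIV. if fst c = b then s $ c * t $ c else 0)"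
    by (rule sum.swap)
  also have "\<dots> = s \<bullet> t"
    by (simp add: inner_vec_def)
  finally show ?thesis .
qed

lemma norm_squared_block_sum: "(\<Sum>b\<in>UNIV. (norm (block b t))\<^sup>2) = (norm t)\<^sup>2"
  by (simp add: power2_norm_eq_inner inner_block_sum)

lemma total_power_eq_norm: "total_power W = (norm W)\<^sup>2"
  by (simp add: total_power_def norm_vec_def L2_set_def sum_nonneg)

text \<open>
  A base station has something to minimize over and a minimum to choose: after completing the
  square, its objective is, up to a constant, the squared distance from a fixed point in the
  coordinates \<open>(W, \<surd>(\<rho> / 2) t)\<close>, and a nonempty closed set has a nearest point.
\<close>

lemma admm_local_solution_is_arg_min:
  fixes bs :: "'k::finite \<Rightarrow> 'b::finite" and H :: "('n::finite, 'k, 'b) channels"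
  assumes gamma_pos: "\<And>k. \<gamma> k > 0" and rho_pos: "\<rho> > 0"
    and feasible: "admm_local_feasible bs \<gamma> \<sigma> H b x0"
  shows "is_arg_min (admm_local_objective bs \<rho> b \<tau> \<nu>) (admm_local_feasible bs \<gamma> \<sigma> H b)
           (admm_local_solution bs \<gamma> \<sigma> \<rho> \<tau> \<nu> H b)"
proof -
  let ?F = "admm_local_feasible bs \<gamma> \<sigma> H b" and ?J = "admm_local_objective bs \<rho> b \<tau> \<nu>"
  define s where "s = block b (copy_matrix bs *v \<tau>)"
  define q where "q = s - (1 / \<rho>) *\<^sub>R block b \<nu>"
  define a where "a = sqrt (\<rho> / 2)"
  have a: "a > 0" "a\<^sup>2 = \<rho> / 2"
    using rho_pos by (simp_all add: a_def)
  have objective: "?J (W, t) = (dist (0, a *\<^sub>R q) (W, a *\<^sub>R t))\<^sup>2 - (norm (block b \<nu>))\<^sup>2 / (2 * \<rho>)"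
    if "?F (W, t)" for W t
  proof -
    have "(\<Sum>j\<in>users bs b. (norm (W $ j))\<^sup>2) = (\<Sum>j\<in>UNIV. (norm (W $ j))\<^sup>2)"
      by (rule sum.mono_neutral_left) (use that in \<open>auto simp: admm_local_feasible_def\<close>)
    then have "(\<Sum>j\<in>users bs b. (norm (W $ j))\<^sup>2) = (norm W)\<^sup>2"
      by (simp add: total_power_eq_norm[symmetric] total_power_def)
    moreover have "block b \<nu> \<bullet> (t - s) + \<rho> / 2 * (norm (t - s))\<^sup>2
        = \<rho> / 2 * (norm (t - q))\<^sup>2 - (norm (block b \<nu>))\<^sup>2 / (2 * \<rho>)"
    proof -
      define e where "e = t - s"
      have tq: "t - q = e + (1 / \<rho>) *\<^sub>R block b \<nu>" by (simp add: e_def q_def)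
      show ?thesis
        unfolding tq e_def[symmetric] power2_norm_eq_inner
        using rho_pos by (simp add: inner_simps inner_commute field_simps)
    qed
    moreover have "(dist (0, a *\<^sub>R q) (W, a *\<^sub>R t))\<^sup>2 = (norm W)\<^sup>2 + \<rho> / 2 * (norm (t - q))\<^sup>2"
      using rho_pos by (simp add: dist_norm norm_Pair scaleR_diff_right[symmetric] power_mult_distrib a(2)
          norm_minus_commute)
    ultimately show ?thesis
      by (simp add: admm_local_objective_def s_def)
  qed
  have "closed (Collect ?F)"
  proof -
    have "Collect ?F = (\<Inter>k\<in>- users bs b. {x. fst x $ k = 0}) \<inter> {x. snd x \<in> copy_space bs}
            \<inter> {x. block b (snd x) = snd x} \<inter> {(W, t). local_constraints bs \<gamma> \<sigma> H b W t}"
      by (auto simp: admm_local_feasible_def)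
    moreover have "closed {x :: ('n, 'k) beams \<times> ('k, 'b) copy_vec. snd x \<in> copy_space bs}"
    proof -
      have "{x :: ('n, 'k) beams \<times> ('k, 'b) copy_vec. snd x \<in> copy_space bs} = UNIV \<times> copy_space bs"
        by auto
      then show ?thesis
        using closed_Times[OF closed_UNIV closed_subspace[OF subspace_copy_space]] by metis
    qed
    moreover have "closed {x :: ('n, 'k) beams \<times> ('k, 'b) copy_vec. block b (snd x) = snd x}"
      unfolding block_def
      by (intro closed_Collect_eq continuous_intros continuous_on_vec_lambda
          continuous_on_constant_if)
    moreover have "closed {x :: ('n, 'k) beams \<times> ('k, 'b) copy_vec. fst x $ k = 0}" for k
      by (intro closed_Collect_eq continuous_intros)
    moreover have "closed {(W, t). local_constraints bs \<gamma> \<sigma> H b W t}"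
      by (rule local_constraints_closed_convex(1)[of \<gamma>, OF gamma_pos])
    ultimately show ?thesis
      by (simp only:) (intro closed_Int closed_INT ballI)
  qed
  then have closed_scaled: "closed ((\<lambda>x. (fst x, (1 / a) *\<^sub>R snd x)) -` Collect ?F)" (is "closed ?S")
    by (rule closed_vimage) (intro continuous_intros)
  have "(fst x0, a *\<^sub>R snd x0) \<in> ?S"
    using feasible a(1) by simp
  then have "?S \<noteq> {}" by blast
  then obtain y where "y \<in> ?S" and S_min: "\<And>z. z \<in> ?S \<Longrightarrow> dist (0, a *\<^sub>R q) y \<le> dist (0, a *\<^sub>R q) z"
    by (rule distance_attains_inf[OF closed_scaled, where a = "(0, a *\<^sub>R q)"]) (rule that)
  from \<open>y \<in> ?S\<close> have y: "?F (fst y, (1 / a) *\<^sub>R snd y)" by simp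
  have y_min: "dist (0, a *\<^sub>R q) y \<le> dist (0, a *\<^sub>R q) z" if "?F (fst z, (1 / a) *\<^sub>R snd z)" for z
    using that by (intro S_min) simp
  have "?J (fst y, (1 / a) *\<^sub>R snd y) \<le> ?J z" if z: "?F z" for z
  proof -
    have "dist (0, a *\<^sub>R q) y \<le> dist (0, a *\<^sub>R q) (fst z, a *\<^sub>R snd z)"
      using y_min[of "(fst z, a *\<^sub>R snd z)"] z a(1) by simp
    then have "(dist (0, a *\<^sub>R q) y)\<^sup>2 \<le> (dist (0, a *\<^sub>R q) (fst z, a *\<^sub>R snd z))\<^sup>2"
      by (simp add: power_mono)
    then show ?thesis
      using objective[OF y] objective[of "fst z" "snd z"] z a(1) by simp
  qed
  then have "is_arg_min ?J ?F (fst y, (1 / a) *\<^sub>R snd y)"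
    using y by (auto simp: is_arg_min_linorder)
  then show ?thesis
    unfolding admm_local_solution_def arg_min_def by (rule someI)
qed

lemma sum_over_base_stations: "(\<Sum>b\<in>UNIV. \<Sum>j\<in>users bs b. g j) = (\<Sum>k\<in>UNIV. g k)"
  for bs :: "'k::finite \<Rightarrow> 'b::finite"
  using sum.group[of "UNIV :: 'k set" "UNIV :: 'b set" bs g] by (simp add: users_def)

text \<open>
  The augmented Lagrangian separates over the base stations: the beam-formers and the blocks of
  copies are partitioned among them, and so are the local constraints. Hence the independently
  computed local solutions fit together to a minimizer over all admissible points.
\<close>

lemma admm_step_minimizes_augmented_lagrangian:
  fixes bs :: "'k::finite \<Rightarrow> 'b::finite" and H :: "('n::finite, 'k, 'b) channels"
    and \<gamma> \<sigma> :: "'k \<Rightarrow> real" and \<rho> :: real and \<tau> :: "('k, 'b) link_vec" and \<nu> :: "('k, 'b) copy_vec"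
  defines "s \<equiv> copy_matrix bs *v \<tau>"
    and "W' \<equiv> admm_W bs \<gamma> \<sigma> \<rho> \<tau> \<nu> H" and "t' \<equiv> admm_t bs \<gamma> \<sigma> \<rho> \<tau> \<nu> H"
  assumes gamma_pos: "\<And>k. \<gamma> k > 0" and rho_pos: "\<rho> > 0"
    and nonempty: "admissible_set bs \<gamma> \<sigma> H \<noteq> {}"
  shows "(W', t') \<in> admissible_set bs \<gamma> \<sigma> H"
    and "(W, t) \<in> admissible_set bs \<gamma> \<sigma> H \<Longrightarrow>
      total_power W' + \<nu> \<bullet> (t' - s) + \<rho> / 2 * (norm (t' - s))\<^sup>2
      \<le> total_power W + \<nu> \<bullet> (t - s) + \<rho> / 2 * (norm (t - s))\<^sup>2"
proof -
  let ?F = "admm_local_feasible bs \<gamma> \<sigma> H" and ?J = "\<lambda>b. admm_local_objective bs \<rho> b \<tau> \<nu>"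
  define sol where "sol b = admm_local_solution bs \<gamma> \<sigma> \<rho> \<tau> \<nu> H b" for b
  define own :: "'b \<Rightarrow> ('n, 'k) beams \<Rightarrow> ('n, 'k) beams"
    where "own b W = (\<chi> k. if k \<in> users bs b then W $ k else 0)" for b W
  \<comment> \<open>Restricting an admissible point to one base station is feasible for that station, ...\<close>
  have restrict: "?F b (own b W, block b t)" if "(W, t) \<in> admissible_set bs \<gamma> \<sigma> H" for b W t
  proof -
    have "local_constraints bs \<gamma> \<sigma> H b W t
        \<longleftrightarrow> local_constraints bs \<gamma> \<sigma> H b (own b W) (block b t)"
      by (rule local_constraints_cong) (simp_all add: own_def block_def)
    then show ?thesis
      using that by (auto simp: admm_local_feasible_def own_def block_def copy_space_def
          admissible_set_def vec_eq_iff)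
  qed
  \<comment> \<open>... the local objectives of the restrictions add up to the augmented Lagrangian, ...\<close>
  have total: "(\<Sum>b\<in>UNIV. ?J b (own b W, block b t))
      = total_power W + \<nu> \<bullet> (t - s) + \<rho> / 2 * (norm (t - s))\<^sup>2" for W t
  proof -
    have diff: "block b t - block b s = block b (t - s)" for b
      by (simp add: block_def vec_eq_iff)
    have "?J b (own b W, block b t) = (\<Sum>j\<in>users bs b. (norm (W $ j))\<^sup>2)
        + block b \<nu> \<bullet> block b (t - s) + \<rho> / 2 * (norm (block b (t - s)))\<^sup>2" for b
      by (simp add: admm_local_objective_def own_def s_def[symmetric] diff)
    then show ?thesis
      by (simp add: sum.distrib sum_over_base_stations inner_block_sum norm_squared_block_sum
          sum_distrib_left[symmetric] sum_divide_distrib[symmetric] total_power_def)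
  qed
  have min: "is_arg_min (?J b) (?F b) (sol b)" for b
  proof -
    obtain W t where "(W, t) \<in> admissible_set bs \<gamma> \<sigma> H" using nonempty by auto
    then show ?thesis
      using admm_local_solution_is_arg_min[of \<gamma>, OF gamma_pos rho_pos restrict]
      by (simp add: sol_def)
  qed
  then have feas: "?F b (sol b)" for b
    by (simp add: is_arg_min_linorder)
  \<comment> \<open>... and the local solutions are the restrictions of the assembled point.\<close>
  have sol: "sol b = (own b W', block b t')" for b
  proof (rule prod_eqI)
    show "fst (sol b) = fst (own b W', block b t')"
      using feas[of b]
      by (auto simp: vec_eq_iff own_def W'_def admm_W_def sol_def[symmetric] users_def
          admm_local_feasible_def split: prod.splits)
    have "block b (snd (sol b)) = snd (sol b)"
      using feas[of b] by (auto simp: admm_local_feasible_def split: prod.splits)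
    then have "snd (sol b) = block b (snd (sol b))" ..
    also have "\<dots> = block b t'"
      by (simp add: vec_eq_iff block_def t'_def admm_t_def sol_def[symmetric])
    finally show "snd (sol b) = snd (own b W', block b t')" by simp
  qed
  show "(W', t') \<in> admissible_set bs \<gamma> \<sigma> H"
  proof -
    have "local_constraints bs \<gamma> \<sigma> H b W' t'" for b
    proof -
      have "local_constraints bs \<gamma> \<sigma> H b W' t'
          \<longleftrightarrow> local_constraints bs \<gamma> \<sigma> H b (own b W') (block b t')"
        by (rule local_constraints_cong) (simp_all add: own_def block_def)
      then show ?thesis
        using feas[of b] by (simp add: sol admm_local_feasible_def)
    qed
    moreover have "t' $ c = 0" if "c \<notin> copies bs" for c
    proof -
      have "snd (sol (fst c)) \<in> copy_space bs"
        using feas[of "fst c"] by (auto simp: admm_local_feasible_def split: prod.splits)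
      then show ?thesis
        using that by (cases c) (simp add: t'_def admm_t_def sol_def[symmetric] copy_space_def)
    qed
    ultimately show ?thesis
      by (simp add: admissible_set_def copy_space_def)
  qed
  assume other: "(W, t) \<in> admissible_set bs \<gamma> \<sigma> H"
  have "(\<Sum>b\<in>UNIV. ?J b (sol b)) \<le> (\<Sum>b\<in>UNIV. ?J b (own b W, block b t))"
    by (rule sum_mono) (use min restrict[OF other] in \<open>auto simp: is_arg_min_linorder\<close>)
  then show "total_power W' + \<nu> \<bullet> (t' - s) + \<rho> / 2 * (norm (t' - s))\<^sup>2
      \<le> total_power W + \<nu> \<bullet> (t - s) + \<rho> / 2 * (norm (t - s))\<^sup>2"
    by (simp only: sol total)
qed

text \<open>
  The first-order condition without differentiating \<open>f\<close>: moving from the minimizer \<open>x\<close> by a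
  fraction \<open>\<theta>\<close> towards \<open>y\<close> changes the objective by at most \<open>\<theta> \<alpha> + \<theta>\<^sup>2 \<beta>\<close>, where \<open>\<alpha>\<close> is
  the difference claimed to be nonnegative. Dividing by \<open>\<theta>\<close> and letting \<open>\<theta>\<close> tend to zero shows
  that the quadratic penalty may be replaced by its linearization at \<open>x\<close>.
\<close>

lemma proximal_minimizer_optimality:
  fixes f :: "'a::real_vector \<Rightarrow> real" and T :: "'a \<Rightarrow> 'e::real_inner"
  assumes f: "convex_on C f" and T: "linear T" and x: "x \<in> C" and y: "y \<in> C"
    and min: "\<And>z. z \<in> C \<Longrightarrow> f x + \<nu> \<bullet> (T x - s) + \<rho> / 2 * (norm (T x - s))\<^sup>2
                             \<le> f z + \<nu> \<bullet> (T z - s) + \<rho> / 2 * (norm (T z - s))\<^sup>2"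
  shows "f x + (\<nu> + \<rho> *\<^sub>R (T x - s)) \<bullet> T x \<le> f y + (\<nu> + \<rho> *\<^sub>R (T x - s)) \<bullet> T y"
proof -
  define \<mu> where "\<mu> = \<nu> + \<rho> *\<^sub>R (T x - s)"
  define e where "e = T y - T x"
  define \<alpha> where "\<alpha> = f y - f x + \<mu> \<bullet> e"
  define \<beta> where "\<beta> = \<rho> / 2 * (norm e)\<^sup>2"
  have slope: "0 \<le> \<alpha> + \<theta> * \<beta>" if \<theta>: "0 < \<theta>" "\<theta> < 1" for \<theta>
  proof -
    define z where "z = (1 - \<theta>) *\<^sub>R x + \<theta> *\<^sub>R y"
    have "convex C" using f by (rule convex_on_imp_convex)
    then have "z \<in> C"
      unfolding z_def using \<theta> x y by (intro convexD_alt) auto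
    have fz: "f z \<le> (1 - \<theta>) * f x + \<theta> * f y"
      unfolding z_def using \<theta> by (intro convex_onD[OF f]) (auto simp: x y)
    have Tz: "T z - s = (T x - s) + \<theta> *\<^sub>R e"
      by (simp add: z_def e_def linear_add[OF T] linear_cmul[OF T]) (simp add: algebra_simps)
    have "0 \<le> f z + \<nu> \<bullet> (T z - s) + \<rho> / 2 * (norm (T z - s))\<^sup>2
              - (f x + \<nu> \<bullet> (T x - s) + \<rho> / 2 * (norm (T x - s))\<^sup>2)"
      using min[OF \<open>z \<in> C\<close>] by simp
    also have "\<dots> = f z - f x + \<theta> * (\<mu> \<bullet> e) + \<theta> * (\<theta> * \<beta>)"
      unfolding Tz \<beta>_def \<mu>_def power2_norm_eq_inner
      by (simp add: inner_simps inner_commute field_simps)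
    also have "\<dots> \<le> \<theta> * (\<alpha> + \<theta> * \<beta>)"
      using fz by (simp add: \<alpha>_def algebra_simps)
    finally show ?thesis using \<theta>(1) by (simp add: zero_le_mult_iff)
  qed
  have "0 \<le> \<alpha>"
  proof (rule tendsto_lowerbound)
    show "((\<lambda>\<theta>. \<alpha> + \<theta> * \<beta>) \<longlongrightarrow> \<alpha>) (at_right 0)"
      by (auto intro!: tendsto_eq_intros)
    show "\<forall>\<^sub>F \<theta> in at_right 0. 0 \<le> \<alpha> + \<theta> * \<beta>"
      using slope unfolding eventually_at_right_field by (intro exI[of _ 1]) auto
  qed simp
  then show ?thesis
    by (simp add: \<alpha>_def \<mu>_def[symmetric] e_def inner_diff_right)
qed

lemma convex_on_total_power:
  assumes "convex C"
  shows "convex_on C (\<lambda>x. total_power (fst x))"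
proof (rule convex_onI)
  fix t :: real and x y :: "(complex ^ 'a ^ 'b) \<times> 'c"
  assume t: "0 < t" "t < 1"
  let ?u = "fst x" and ?v = "fst y"
  have "(1 - t) * (norm ?u)\<^sup>2 + t * (norm ?v)\<^sup>2 - (norm ((1 - t) *\<^sub>R ?u + t *\<^sub>R ?v))\<^sup>2
        = t * (1 - t) * (norm (?u - ?v))\<^sup>2"
    unfolding power2_norm_eq_inner by (simp add: inner_simps inner_commute algebra_simps)
  moreover have "\<dots> \<ge> 0" using t by simp
  ultimately show "total_power (fst ((1 - t) *\<^sub>R x + t *\<^sub>R y))
      \<le> (1 - t) * total_power (fst x) + t * total_power (fst y)"
    by (simp add: total_power_eq_norm)
qed (rule assms)

text \<open>
  The new primal iterate minimizes an ordinary Lagrangian, with the multiplier corrected by the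
  gradient of the penalty.
\<close>

lemma admm_step_minimizes_lagrangian:
  fixes bs :: "'k::finite \<Rightarrow> 'b::finite" and H :: "('n::finite, 'k, 'b) channels"
    and \<gamma> \<sigma> :: "'k \<Rightarrow> real" and \<rho> :: real and \<tau> :: "('k, 'b) link_vec" and \<nu> :: "('k, 'b) copy_vec"
  defines "W' \<equiv> admm_W bs \<gamma> \<sigma> \<rho> \<tau> \<nu> H" and "t' \<equiv> admm_t bs \<gamma> \<sigma> \<rho> \<tau> \<nu> H"
  assumes gamma_pos: "\<And>k. \<gamma> k > 0" and rho_pos: "\<rho> > 0"
    and Wt: "(W, t) \<in> admissible_set bs \<gamma> \<sigma> H"
  shows "total_power W' + (\<nu> + \<rho> *\<^sub>R (t' - copy_matrix bs *v \<tau>)) \<bullet> t'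
         \<le> total_power W + (\<nu> + \<rho> *\<^sub>R (t' - copy_matrix bs *v \<tau>)) \<bullet> t"
proof -
  have nonempty: "admissible_set bs \<gamma> \<sigma> H \<noteq> {}" using Wt by blast
  note step = admm_step_minimizes_augmented_lagrangian[of \<gamma>, OF gamma_pos rho_pos nonempty, where \<tau> = \<tau> and \<nu> = \<nu>]
  show ?thesis
    using proximal_minimizer_optimality[OF convex_on_total_power[OF convex_admissible_set[of \<gamma>, OF gamma_pos]]
        linear_snd step(1) Wt, of \<nu> "copy_matrix bs *v \<tau>" \<rho>] step(2)
    by (auto simp: W'_def t'_def)
qed

section \<open>The copy matrix and its pseudo-inverse\<close>

text \<open>
  Products with the transposed copy matrix are kept in this form, since their components (the sum
  of the two copies held for a link) are the meaningful quantities below.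
\<close>

declare transpose_matrix_vector [simp del]

lemma copy_matrix_mult_nth:
  "(copy_matrix bs *v \<tau>) $ c = (if c \<in> copies bs then \<tau> $ snd c else 0)"
  by (simp add: copy_matrix_def matrix_vector_mult_def if_distrib[of "\<lambda>x. x * _"] cong: if_cong)

lemma transpose_copy_matrix_mult_nth:
  "(transpose (copy_matrix bs) *v t) $ (m, k)
   = (if (m, k) \<in> links bs then t $ (m, m, k) + t $ (bs k, m, k) else 0)"
proof -
  have "(transpose (copy_matrix bs) *v t) $ (m, k)
        = (\<Sum>c\<in>UNIV. if c \<in> copies bs \<and> snd c = (m, k) then t $ c else 0)"
    by (simp add: copy_matrix_def matrix_vector_mult_def transpose_def if_distrib[of "\<lambda>x. x * _"]
        cong: if_cong)
  also have "\<dots> = (\<Sum>c\<in>{c \<in> copies bs. snd c = (m, k)}. t $ c)"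
    by (rule sum.mono_neutral_cong_right) auto
  also have "{c \<in> copies bs. snd c = (m, k)}
             = (if (m, k) \<in> links bs then {(m, m, k), (bs k, m, k)} else {})"
    by (auto simp: copies_def links_def)
  finally show ?thesis by (auto simp: links_def)
qed

text \<open>
  Each link is copied exactly twice, because \<open>m \<noteq> bs k\<close> makes the two holders distinct. So
  \<open>E\<^sup>T E\<close> is twice the projection onto the link space, which leads to the pseudo-inverse of \<open>E\<close>
  and bounds \<open>\<tau>\<close> in terms of \<open>E \<tau>\<close>.
\<close>

lemma transpose_copy_matrix_copy_matrix:
  "transpose (copy_matrix bs) *v (copy_matrix bs *v \<tau>) = (\<chi> l. if l \<in> links bs then 2 * \<tau> $ l else 0)"
proof (simp only: vec_eq_iff, intro allI)
  fix l
  show "(transpose (copy_matrix bs) *v (copy_matrix bs *v \<tau>)) $ l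
        = (\<chi> l. if l \<in> links bs then 2 * \<tau> $ l else 0) $ l"
    by (cases l) (simp add: transpose_copy_matrix_mult_nth copy_matrix_mult_nth copies_def links_def)
qed

lemma copy_matrix_mult_links:
  "copy_matrix bs *v (\<chi> l. if l \<in> links bs then a * \<tau> $ l else 0) = a *\<^sub>R (copy_matrix bs *v \<tau>)"
  by (auto simp: vec_eq_iff copy_matrix_mult_nth copies_def links_def)

lemma copy_matrix_mult_in_copy_space: "copy_matrix bs *v \<tau> \<in> copy_space bs"
  by (simp add: copy_space_def copy_matrix_mult_nth)

lemma transpose_copy_matrix_mult_in_link_space: "transpose (copy_matrix bs) *v t \<in> link_space bs"
  by (auto simp: link_space_def transpose_copy_matrix_mult_nth)

lemma inner_copy_matrix: "\<nu> \<bullet> (copy_matrix bs *v \<tau>) = (transpose (copy_matrix bs) *v \<nu>) \<bullet> \<tau>"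
  by (simp add: transpose_matrix_vector dot_lmul_matrix)

lemma norm_copy_matrix_mult:
  assumes "\<tau> \<in> link_space bs"
  shows "(norm (copy_matrix bs *v \<tau>))\<^sup>2 = 2 * (norm \<tau>)\<^sup>2"
proof -
  have "(\<chi> l. if l \<in> links bs then 2 * \<tau> $ l else 0) = 2 *\<^sub>R \<tau>"
    using assms by (auto simp: vec_eq_iff link_space_def)
  then show ?thesis
    unfolding power2_norm_eq_inner inner_copy_matrix transpose_copy_matrix_copy_matrix by simp
qed

text \<open>
  Uniqueness of the pseudo-inverse: the projections \<open>A Y\<close> and \<open>Y A\<close> are symmetric with range and
  kernel determined by \<open>A\<close>, and \<open>Y = (Y A) Y = Y (A Y)\<close> depends on these projections only.
\<close>

lemma pseudo_inverse_eqI: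
  assumes X: "is_pseudo_inverse A X"
  shows "pseudo_inverse A = X"
  unfolding pseudo_inverse_def
proof (rule the_equality)
  show "is_pseudo_inverse A X" by (rule X)
  have unique_projections: "A ** Z = A ** Y \<and> Z ** A = Y ** A"
    if "is_pseudo_inverse A Y" "is_pseudo_inverse A Z" for Y Z
  proof
    have Y: "A ** Y ** A = A" "transpose (A ** Y) = A ** Y" "transpose (Y ** A) = Y ** A"
      and Z: "A ** Z ** A = A" "transpose (A ** Z) = A ** Z" "transpose (Z ** A) = Z ** A"
      using that by (auto simp: is_pseudo_inverse_def)
    have "A ** Z = transpose ((A ** Y ** A) ** Z)" using Y Z by simp
    also have "\<dots> = transpose (A ** Z) ** transpose (A ** Y)"
      by (simp add: matrix_transpose_mul[symmetric] matrix_mul_assoc)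
    also have "\<dots> = (A ** Z ** A) ** Y" by (simp only: Y(2) Z(2) matrix_mul_assoc)
    finally show "A ** Z = A ** Y" using Z by simp
    have "Z ** A = transpose (Z ** (A ** Y ** A))" using Y Z by simp
    also have "\<dots> = transpose (Y ** A) ** transpose (Z ** A)"
      by (simp add: matrix_transpose_mul[symmetric] matrix_mul_assoc)
    also have "\<dots> = Y ** (A ** Z ** A)" by (simp only: Y(3) Z(3) matrix_mul_assoc)
    finally show "Z ** A = Y ** A" using Z by simp
  qed
  fix Z assume Z: "is_pseudo_inverse A Z"
  have "Z = (Z ** A) ** Z" using Z by (simp add: is_pseudo_inverse_def)
  also have "\<dots> = X ** A ** Z"
    using unique_projections[OF X Z] by simp
  also have "\<dots> = X ** (A ** Z)"
    by (rule matrix_mul_assoc[symmetric])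
  also have "\<dots> = X ** (A ** X)"
    using unique_projections[OF X Z] by simp
  finally show "Z = X" using X by (simp add: is_pseudo_inverse_def matrix_mul_assoc)
qed

text \<open>The update of \<open>\<tau>\<close> averages the two copies of each link.\<close>

lemma pseudo_inverse_copy_matrix:
  "pseudo_inverse (copy_matrix bs) = (1 / 2) *\<^sub>R transpose (copy_matrix bs)"
proof (rule pseudo_inverse_eqI)
  let ?E = "copy_matrix bs" and ?X = "(1 / 2) *\<^sub>R transpose (copy_matrix bs)"
  have X: "?X *v t = (1 / 2) *\<^sub>R (transpose ?E *v t)" for t
    by (simp add: scaleR_matrix_vector_assoc[symmetric])
  have XE: "?X *v (?E *v \<tau>) = (\<chi> l. if l \<in> links bs then 1 * \<tau> $ l else 0)" for \<tau>
    by (simp add: X transpose_copy_matrix_copy_matrix vec_eq_iff)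
  have "?E ** ?X ** ?E = ?E"
    by (subst matrix_eq)
      (simp add: matrix_vector_mul_assoc[symmetric] XE copy_matrix_mult_links del: mult_1)
  moreover have "?X ** ?E ** ?X = ?X"
  proof (subst matrix_eq, intro allI)
    fix t
    have "?X *v t \<in> link_space bs"
      unfolding X using transpose_copy_matrix_mult_in_link_space subspace_link_space
      by (rule subspace_scale[rotated])
    then have "?X *v (?E *v (?X *v t)) = ?X *v t"
      unfolding XE by (auto simp: vec_eq_iff link_space_def)
    then show "(?X ** ?E ** ?X) *v t = ?X *v t"
      by (simp add: matrix_vector_mul_assoc[symmetric])
  qed
  moreover have "transpose (?E ** ?X) = ?E ** ?X" "transpose (?X ** ?E) = ?X ** ?E"
    by (simp_all add: vec_eq_iff matrix_matrix_mult_def transpose_def mult.commute)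
  ultimately show "is_pseudo_inverse ?E ?X"
    by (simp add: is_pseudo_inverse_def)
qed

text \<open>
  The multiplier is updated along this residual. Hence \<open>E\<^sup>T \<nu> = 0\<close> is preserved by the algorithm,
  and the changes of \<open>\<nu>\<close> and of \<open>E \<tau>\<close> are orthogonal to each other.
\<close>

lemma copy_residual_orthogonal:
  "transpose (copy_matrix bs) *v (t - copy_matrix bs *v (pseudo_inverse (copy_matrix bs) *v t)) = 0"
proof -
  have "transpose (copy_matrix bs) *v (copy_matrix bs *v (transpose (copy_matrix bs) *v t))
        = 2 *\<^sub>R (transpose (copy_matrix bs) *v t)"
    unfolding transpose_copy_matrix_copy_matrix
    using transpose_copy_matrix_mult_in_link_space[of bs t] by (auto simp: vec_eq_iff link_space_def)
  then show ?thesis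
    by (simp add: pseudo_inverse_copy_matrix matrix_vector_mult_diff_distrib matrix_vector_mult_scaleR
        scaleR_matrix_vector_assoc[symmetric])
qed

section \<open>Optimal points as saddle points\<close>

text \<open>
  The Lagrangian is affine in \<open>\<tau>\<close>, which is unconstrained apart from its support, so it has a
  minimum only if its slope \<open>-E\<^sup>T \<nu>\<close> is zero; otherwise moving \<open>\<tau>\<close> along \<open>E\<^sup>T \<nu>\<close> decreases it.
\<close>

lemma optimal_multiplier_kernel:
  assumes "optimal_multiplier bs \<gamma> \<sigma> H \<nu>"
  shows "transpose (copy_matrix bs) *v \<nu> = 0"
proof -
  let ?g = "transpose (copy_matrix bs) *v \<nu>"
  obtain W t \<tau> where min: "is_arg_min (lagrangian bs \<nu>) (locally_feasible bs \<gamma> \<sigma> H) (W, t, \<tau>)"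
    using assms by (auto simp: optimal_multiplier_def)
  then have feas: "locally_feasible bs \<gamma> \<sigma> H (W, t, \<tau>)" by (simp add: is_arg_min_linorder)
  have "\<tau> + ?g \<in> link_space bs"
    using feas by (intro subspace_add[OF subspace_link_space] transpose_copy_matrix_mult_in_link_space)
      (simp add: locally_feasible_def)
  then have "locally_feasible bs \<gamma> \<sigma> H (W, t, \<tau> + ?g)"
    using feas by (simp add: locally_feasible_def)
  then have "lagrangian bs \<nu> (W, t, \<tau>) \<le> lagrangian bs \<nu> (W, t, \<tau> + ?g)"
    using min by (simp add: is_arg_min_linorder)
  then have "?g \<bullet> ?g \<le> 0"
    by (simp add: lagrangian_def inner_diff_right matrix_vector_right_distrib inner_add_right
        inner_copy_matrix)
  then show ?thesis by (metis inner_gt_zero_iff not_less)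
qed

text \<open>
  Since \<open>E\<^sup>T \<nu>\<^sup>\<star> = 0\<close>, the variable \<open>\<tau>\<close> drops out of the Lagrangian, and the optimal primal
  point minimizes power plus \<open>\<nu>\<^sup>\<star> \<bullet> t\<close> over the admissible set. Uniqueness of the optimal \<open>\<tau>\<close>
  identifies the one that belongs to the multiplier with \<open>\<tau>\<^sup>\<star>\<close>.
\<close>

lemma star_saddle_point:
  assumes tau: "\<exists>!\<tau>. optimal_tau bs \<gamma> \<sigma> H \<tau>" and nu: "\<exists>!\<nu>. optimal_multiplier bs \<gamma> \<sigma> H \<nu>"
  obtains W where "(W, copy_matrix bs *v tau_star bs \<gamma> \<sigma> H) \<in> admissible_set bs \<gamma> \<sigma> H"
    and "tau_star bs \<gamma> \<sigma> H \<in> link_space bs" and "nu_star bs \<gamma> \<sigma> H \<in> copy_space bs"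
    and "transpose (copy_matrix bs) *v nu_star bs \<gamma> \<sigma> H = 0"
    and "\<And>W' t'. (W', t') \<in> admissible_set bs \<gamma> \<sigma> H \<Longrightarrow>
           total_power W \<le> total_power W' + nu_star bs \<gamma> \<sigma> H \<bullet> t'"
proof -
  let ?\<tau> = "tau_star bs \<gamma> \<sigma> H" and ?\<nu> = "nu_star bs \<gamma> \<sigma> H"
  have \<nu>: "optimal_multiplier bs \<gamma> \<sigma> H ?\<nu>"
    unfolding nu_star_def using nu by (rule theI')
  then obtain W t \<tau> where opt: "distributed_optimal bs \<gamma> \<sigma> H (W, t, \<tau>)"
    and min: "is_arg_min (lagrangian bs ?\<nu>) (locally_feasible bs \<gamma> \<sigma> H) (W, t, \<tau>)"
    by (auto simp: optimal_multiplier_def)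
  have "optimal_tau bs \<gamma> \<sigma> H \<tau>" using opt by (auto simp: optimal_tau_def)
  then have \<tau>: "\<tau> = ?\<tau>"
    unfolding tau_star_def using tau by (metis the1_equality)
  have feas: "locally_feasible bs \<gamma> \<sigma> H (W, t, ?\<tau>)" and t: "t = copy_matrix bs *v ?\<tau>"
    using opt by (auto simp: distributed_optimal_def is_arg_min_linorder \<tau>)
  note kernel = optimal_multiplier_kernel[OF \<nu>]
  show thesis
  proof (rule that)
    show "(W, copy_matrix bs *v ?\<tau>) \<in> admissible_set bs \<gamma> \<sigma> H"
      using feas by (simp add: t locally_feasible_def admissible_set_def)
    show \<tau>_link: "?\<tau> \<in> link_space bs" using feas by (simp add: locally_feasible_def)
    show "?\<nu> \<in> copy_space bs" using \<nu> by (simp add: optimal_multiplier_def)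
    show "transpose (copy_matrix bs) *v ?\<nu> = 0" by (rule kernel)
    fix W' t'
    assume "(W', t') \<in> admissible_set bs \<gamma> \<sigma> H"
    then have "locally_feasible bs \<gamma> \<sigma> H (W', t', ?\<tau>)"
      using \<tau>_link by (simp add: locally_feasible_def admissible_set_def)
    then have "lagrangian bs ?\<nu> (W, t, ?\<tau>) \<le> lagrangian bs ?\<nu> (W', t', ?\<tau>)"
      using min by (simp add: is_arg_min_linorder \<tau>)
    then show "total_power W \<le> total_power W' + ?\<nu> \<bullet> t'"
      by (simp add: lagrangian_def t inner_diff_right inner_copy_matrix kernel)
  qed
qed

text \<open>Conversely, a consistent admissible point with this minimality property is optimal.\<close>

lemma saddle_point_optimal:
  assumes adm: "(W, copy_matrix bs *v \<tau>) \<in> admissible_set bs \<gamma> \<sigma> H"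
    and \<tau>: "\<tau> \<in> link_space bs" and \<nu>: "\<nu> \<in> copy_space bs"
    and kernel: "transpose (copy_matrix bs) *v \<nu> = 0"
    and min: "\<And>W' t'. (W', t') \<in> admissible_set bs \<gamma> \<sigma> H \<Longrightarrow>
                total_power W \<le> total_power W' + \<nu> \<bullet> t'"
  shows "optimal_tau bs \<gamma> \<sigma> H \<tau>" and "optimal_multiplier bs \<gamma> \<sigma> H \<nu>"
proof -
  have feas: "locally_feasible bs \<gamma> \<sigma> H (W, copy_matrix bs *v \<tau>, \<tau>)"
    using adm \<tau> by (simp add: locally_feasible_def admissible_set_def)
  have lag: "lagrangian bs \<nu> (W', t', \<tau>') = total_power W' + \<nu> \<bullet> t'" for W' :: "('a, 'b) beams" and t' \<tau>'
    by (simp add: lagrangian_def inner_diff_right inner_copy_matrix kernel)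
  have opt: "distributed_optimal bs \<gamma> \<sigma> H (W, copy_matrix bs *v \<tau>, \<tau>)"
  proof -
    have "total_power W \<le> total_power W'"
      if "locally_feasible bs \<gamma> \<sigma> H (W', copy_matrix bs *v \<tau>', \<tau>')" for W' \<tau>'
      using min[of W' "copy_matrix bs *v \<tau>'"] that
      by (simp add: locally_feasible_def admissible_set_def inner_copy_matrix kernel)
    then show ?thesis
      using feas by (auto simp: distributed_optimal_def is_arg_min_linorder)
  qed
  then show "optimal_tau bs \<gamma> \<sigma> H \<tau>" by (auto simp: optimal_tau_def)
  have "lagrangian bs \<nu> (W, copy_matrix bs *v \<tau>, \<tau>) \<le> lagrangian bs \<nu> (W', t', \<tau>')"
    if "locally_feasible bs \<gamma> \<sigma> H (W', t', \<tau>')" for W' t' \<tau>'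
    using min[of W' t'] that
    by (simp add: lag locally_feasible_def admissible_set_def inner_copy_matrix kernel)
  then have "is_arg_min (lagrangian bs \<nu>) (locally_feasible bs \<gamma> \<sigma> H) (W, copy_matrix bs *v \<tau>, \<tau>)"
    using feas by (auto simp: is_arg_min_linorder)
  then show "optimal_multiplier bs \<gamma> \<sigma> H \<nu>"
    using opt \<nu> by (auto simp: optimal_multiplier_def)
qed

section \<open>The Lyapunov function decreases at fixed channels\<close>

definition admm_step ::
  "('k::finite \<Rightarrow> 'b::finite) \<Rightarrow> ('k \<Rightarrow> real) \<Rightarrow> ('k \<Rightarrow> real) \<Rightarrow> real
     \<Rightarrow> ('k, 'b) link_vec \<times> ('k, 'b) copy_vec \<Rightarrow> ('n::finite, 'k, 'b) channels
     \<Rightarrow> ('k, 'b) link_vec \<times> ('k, 'b) copy_vec" where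
  "admm_step bs \<gamma> \<sigma> \<rho> = (\<lambda>(\<tau>, \<nu>) H. (admm_tau bs \<gamma> \<sigma> \<rho> \<tau> \<nu> H, admm_nu bs \<gamma> \<sigma> \<rho> \<tau> \<nu> H))"

text \<open>
  The pairs \<open>(\<tau>, \<nu>)\<close> that the algorithm can visit: besides having the right supports, they keep
  the relation \<open>E\<^sup>T \<nu> = 0\<close> of the initial values.
\<close>

definition admm_states :: "('k::finite \<Rightarrow> 'b::finite) \<Rightarrow> (('k, 'b) link_vec \<times> ('k, 'b) copy_vec) set" where
  "admm_states bs = link_space bs \<times> {\<nu> \<in> copy_space bs. transpose (copy_matrix bs) *v \<nu> = 0}"

text \<open>
  The squared length of the last step in the metric of the Lyapunov function, which bounds the
  decrease from below.
\<close>

definition lyapunov_decrease ::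
  "('k::finite \<Rightarrow> 'b::finite) \<Rightarrow> ('k \<Rightarrow> real) \<Rightarrow> ('k \<Rightarrow> real) \<Rightarrow> real
     \<Rightarrow> ('k, 'b) link_vec \<times> ('k, 'b) copy_vec \<Rightarrow> ('n::finite, 'k, 'b) channels \<Rightarrow> real" where
  "lyapunov_decrease bs \<gamma> \<sigma> \<rho> = (\<lambda>(\<tau>, \<nu>) H.
     1 / \<rho> * (norm (admm_nu bs \<gamma> \<sigma> \<rho> \<tau> \<nu> H - \<nu>))\<^sup>2
     + \<rho> * (norm (copy_matrix bs *v (admm_tau bs \<gamma> \<sigma> \<rho> \<tau> \<nu> H - \<tau>)))\<^sup>2)"

lemma admm_step_in_admm_states:
  assumes gamma_pos: "\<And>k. \<gamma> k > 0" and rho_pos: "\<rho> > 0"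
    and nonempty: "admissible_set bs \<gamma> \<sigma> H \<noteq> {}" and z: "z \<in> admm_states bs"
  shows "admm_step bs \<gamma> \<sigma> \<rho> z H \<in> admm_states bs"
proof -
  obtain \<tau> \<nu> where z_eq: "z = (\<tau>, \<nu>)" by fastforce
  let ?t = "admm_t bs \<gamma> \<sigma> \<rho> \<tau> \<nu> H" and ?\<tau> = "admm_tau bs \<gamma> \<sigma> \<rho> \<tau> \<nu> H"
  have t: "?t \<in> copy_space bs"
    using admm_step_minimizes_augmented_lagrangian(1)[of \<gamma>, OF gamma_pos rho_pos nonempty, where \<tau> = \<tau> and \<nu> = \<nu>]
    by (simp add: admissible_set_def)
  have "?\<tau> \<in> link_space bs"
    by (simp add: admm_tau_def pseudo_inverse_copy_matrix scaleR_matrix_vector_assoc[symmetric]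
        subspace_scale subspace_link_space transpose_copy_matrix_mult_in_link_space)
  moreover have "admm_nu bs \<gamma> \<sigma> \<rho> \<tau> \<nu> H \<in> copy_space bs"
    using z t by (auto simp: z_eq admm_nu_def admm_states_def
        intro!: subspace_add subspace_scale subspace_diff subspace_copy_space copy_matrix_mult_in_copy_space)
  moreover have "transpose (copy_matrix bs) *v admm_nu bs \<gamma> \<sigma> \<rho> \<tau> \<nu> H = 0"
    using z copy_residual_orthogonal[of bs ?t]
    by (simp add: z_eq admm_nu_def admm_tau_def admm_states_def matrix_vector_right_distrib
        matrix_vector_mult_scaleR)
  ultimately show ?thesis by (simp add: z_eq admm_step_def admm_states_def)
qed

text \<open>
  Two minimality properties are played against each other. The optimal primal point is compared
  with the new iterate \<open>(W', t')\<close> in the Lagrangian with multiplier \<open>\<nu>\<^sup>\<star>\<close>, and the new iterate with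
  the optimal point in the Lagrangian with multiplier \<open>\<nu>' + \<rho> E (\<tau>' - \<tau>)\<close>. Adding the two
  inequalities cancels the powers. With \<open>r = t' - E \<tau>'\<close> and all multipliers orthogonal to the range
  of \<open>E\<close>, what remains is \<open>(\<nu>' - \<nu>\<^sup>\<star>) \<bullet> r + \<rho> E (\<tau>' - \<tau>) \<bullet> E (\<tau>' - \<tau>\<^sup>\<star>) \<le> 0\<close>.
  As \<open>\<nu>' - \<nu> = \<rho> r\<close>, this says that the step makes an obtuse angle with the displacement from the
  optimum after the step, so that the squared distance drops by at least the squared step length.
\<close>

lemma lyapunov_descent:
  assumes gamma_pos: "\<And>k. \<gamma> k > 0" and rho_pos: "\<rho> > 0"
    and tau: "\<exists>!\<tau>. optimal_tau bs \<gamma> \<sigma> H \<tau>" and nu: "\<exists>!\<nu>. optimal_multiplier bs \<gamma> \<sigma> H \<nu>"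
    and kernel: "transpose (copy_matrix bs) *v \<nu> = 0"
  shows "lyapunov bs \<gamma> \<sigma> \<rho> (admm_nu bs \<gamma> \<sigma> \<rho> \<tau> \<nu> H) (admm_tau bs \<gamma> \<sigma> \<rho> \<tau> \<nu> H) H
         + lyapunov_decrease bs \<gamma> \<sigma> \<rho> (\<tau>, \<nu>) H \<le> lyapunov bs \<gamma> \<sigma> \<rho> \<nu> \<tau> H"
proof -
  let ?E = "copy_matrix bs"
  define \<tau>s \<nu>s where "\<tau>s = tau_star bs \<gamma> \<sigma> H" and "\<nu>s = nu_star bs \<gamma> \<sigma> H"
  define W' t' \<tau>' \<nu>' where "W' = admm_W bs \<gamma> \<sigma> \<rho> \<tau> \<nu> H" and "t' = admm_t bs \<gamma> \<sigma> \<rho> \<tau> \<nu> H"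
    and "\<tau>' = admm_tau bs \<gamma> \<sigma> \<rho> \<tau> \<nu> H" and "\<nu>' = admm_nu bs \<gamma> \<sigma> \<rho> \<tau> \<nu> H"
  define r where "r = t' - ?E *v \<tau>'"
  obtain Ws where adm: "(Ws, ?E *v \<tau>s) \<in> admissible_set bs \<gamma> \<sigma> H"
    and kernel_s: "transpose ?E *v \<nu>s = 0"
    and saddle: "\<And>W t. (W, t) \<in> admissible_set bs \<gamma> \<sigma> H \<Longrightarrow> total_power Ws \<le> total_power W + \<nu>s \<bullet> t"
    using star_saddle_point[OF tau nu] unfolding \<tau>s_def \<nu>s_def by metis
  have nonempty: "admissible_set bs \<gamma> \<sigma> H \<noteq> {}" using adm by blast
  have "(W', t') \<in> admissible_set bs \<gamma> \<sigma> H"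
    unfolding W'_def t'_def
    by (rule admm_step_minimizes_augmented_lagrangian(1)[of \<gamma>, OF gamma_pos rho_pos nonempty])
  note 1 = saddle[OF this]
  have \<nu>': "\<nu>' = \<nu> + \<rho> *\<^sub>R r"
    by (simp add: \<nu>'_def admm_nu_def r_def t'_def \<tau>'_def)
  have kernel_r: "transpose ?E *v r = 0"
    unfolding r_def t'_def \<tau>'_def admm_tau_def by (rule copy_residual_orthogonal)
  have kernel': "transpose ?E *v \<nu>' = 0"
    by (simp add: \<nu>' matrix_vector_right_distrib matrix_vector_mult_scaleR kernel kernel_r)
  \<comment> \<open>The corrected multiplier of the local problems, expressed by the updated variables.\<close>
  have gradient: "\<nu> + \<rho> *\<^sub>R (t' - ?E *v \<tau>) = \<nu>' + \<rho> *\<^sub>R (?E *v (\<tau>' - \<tau>))"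
    by (simp add: \<nu>' r_def matrix_vector_mult_diff_distrib algebra_simps)
  have 2: "total_power W' + (\<nu>' + \<rho> *\<^sub>R (?E *v (\<tau>' - \<tau>))) \<bullet> t'
           \<le> total_power Ws + (\<nu>' + \<rho> *\<^sub>R (?E *v (\<tau>' - \<tau>))) \<bullet> (?E *v \<tau>s)"
    unfolding gradient[symmetric] W'_def t'_def
    by (rule admm_step_minimizes_lagrangian[of \<gamma>, OF gamma_pos rho_pos adm])
  have perp: "\<nu>' \<bullet> (?E *v x) = 0" "\<nu>s \<bullet> (?E *v x) = 0" "r \<bullet> (?E *v x) = 0" "(?E *v x) \<bullet> r = 0" for x
    by (simp_all add: inner_copy_matrix kernel' kernel_s kernel_r inner_commute[of _ r])
  have t': "t' = ?E *v \<tau>' + r" by (simp add: r_def)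
  define p q where "p = ?E *v (\<tau>' - \<tau>)" and "q = ?E *v (\<tau>' - \<tau>s)"
  have key: "(\<nu>' - \<nu>s) \<bullet> r + \<rho> * (p \<bullet> q) \<le> 0"
  proof -
    have q: "q = ?E *v \<tau>' - ?E *v \<tau>s" by (simp add: q_def matrix_vector_mult_diff_distrib)
    have "p \<bullet> r = 0" by (simp add: p_def perp)
    then show ?thesis
      using 1 2 unfolding t' p_def[symmetric]
      by (simp add: q inner_simps perp) (simp add: algebra_simps)
  qed
  have \<nu>_diff: "\<nu>' - \<nu> = \<rho> *\<^sub>R r" and \<nu>_star: "\<nu> - \<nu>s = (\<nu>' - \<nu>s) - \<rho> *\<^sub>R r"
    by (simp_all add: \<nu>')
  have \<tau>_star: "?E *v (\<tau> - \<tau>s) = q - p"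
    by (simp add: p_def q_def matrix_vector_mult_diff_distrib)
  \<comment> \<open>Expanding the squares \<open>|a - b|\<^sup>2 = |a|\<^sup>2 + |b|\<^sup>2 - 2 (a \<bullet> b)\<close> of both displacements.\<close>
  have "lyapunov bs \<gamma> \<sigma> \<rho> \<nu> \<tau> H
        = lyapunov bs \<gamma> \<sigma> \<rho> \<nu>' \<tau>' H + lyapunov_decrease bs \<gamma> \<sigma> \<rho> (\<tau>, \<nu>) H
          - 2 * ((\<nu>' - \<nu>s) \<bullet> r + \<rho> * (p \<bullet> q))"
    unfolding lyapunov_def lyapunov_decrease_def prod.case
      \<tau>s_def[symmetric] \<nu>s_def[symmetric] \<tau>'_def[symmetric] \<nu>'_def[symmetric]
      \<nu>_diff \<nu>_star \<tau>_star p_def[symmetric] q_def[symmetric] power2_norm_eq_inner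
    using rho_pos by (simp add: inner_simps inner_commute field_simps)
  then show ?thesis
    using key by (simp add: \<tau>'_def \<nu>'_def)
qed

text \<open>
  If a step moves neither \<open>\<nu>\<close> nor \<open>E \<tau>\<close>, the residual and the gradient of the penalty vanish. The
  iterate is then consistent and minimizes the Lagrangian with multiplier \<open>\<nu>\<close>, hence \<open>\<tau>\<close> and
  \<open>\<nu>\<close> are optimal, and by uniqueness they are the optima that the Lyapunov function refers to.
\<close>

lemma lyapunov_decrease_zero:
  assumes gamma_pos: "\<And>k. \<gamma> k > 0" and rho_pos: "\<rho> > 0"
    and tau: "\<exists>!\<tau>. optimal_tau bs \<gamma> \<sigma> H \<tau>" and nu: "\<exists>!\<nu>. optimal_multiplier bs \<gamma> \<sigma> H \<nu>"
    and z: "(\<tau>, \<nu>) \<in> admm_states bs"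
    and no_decrease: "lyapunov_decrease bs \<gamma> \<sigma> \<rho> (\<tau>, \<nu>) H = 0"
  shows "lyapunov bs \<gamma> \<sigma> \<rho> \<nu> \<tau> H = 0"
proof -
  let ?E = "copy_matrix bs"
  define W' t' where "W' = admm_W bs \<gamma> \<sigma> \<rho> \<tau> \<nu> H" and "t' = admm_t bs \<gamma> \<sigma> \<rho> \<tau> \<nu> H"
  have nonempty: "admissible_set bs \<gamma> \<sigma> H \<noteq> {}"
    by (rule star_saddle_point[OF tau nu]) blast
  have "admm_nu bs \<gamma> \<sigma> \<rho> \<tau> \<nu> H = \<nu>" and "?E *v admm_tau bs \<gamma> \<sigma> \<rho> \<tau> \<nu> H = ?E *v \<tau>"
    using no_decrease rho_pos
    by (auto simp: lyapunov_decrease_def matrix_vector_mult_diff_distrib add_nonneg_eq_0_iff)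
  then have fixed: "t' = ?E *v \<tau>"
    using rho_pos by (simp add: admm_nu_def t'_def)
  have "(W', t') \<in> admissible_set bs \<gamma> \<sigma> H"
    unfolding W'_def t'_def
    by (rule admm_step_minimizes_augmented_lagrangian(1)[of \<gamma>, OF gamma_pos rho_pos nonempty])
  then have adm: "(W', ?E *v \<tau>) \<in> admissible_set bs \<gamma> \<sigma> H" by (simp only: fixed)
  have \<tau>: "\<tau> \<in> link_space bs" and \<nu>: "\<nu> \<in> copy_space bs" "transpose ?E *v \<nu> = 0"
    using z by (simp_all add: admm_states_def)
  have min: "total_power W' \<le> total_power W + \<nu> \<bullet> t" if "(W, t) \<in> admissible_set bs \<gamma> \<sigma> H" for W t
    using admm_step_minimizes_lagrangian[of \<gamma>, OF gamma_pos rho_pos that, where \<tau> = \<tau> and \<nu> = \<nu>] \<nu>(2)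
    by (simp add: W'_def[symmetric] t'_def[symmetric] fixed inner_copy_matrix)
  have "tau_star bs \<gamma> \<sigma> H = \<tau>" "nu_star bs \<gamma> \<sigma> H = \<nu>"
    unfolding tau_star_def nu_star_def using saddle_point_optimal[OF adm \<tau> \<nu> min] tau nu
    by (simp_all add: the1_equality)
  then show ?thesis by (simp add: lyapunov_def)
qed

section \<open>Continuity and coercivity of the Lyapunov function\<close>

lemma continuous_on_lyapunov:
  assumes "continuous_on P (tau_star bs \<gamma> \<sigma>)" and "continuous_on P (nu_star bs \<gamma> \<sigma>)"
  shows "continuous_on (A \<times> P) (\<lambda>(z, H). lyapunov bs \<gamma> \<sigma> \<rho> (snd z) (fst z) H)"
proof -
  have "continuous_on (A \<times> P) (\<lambda>x. tau_star bs \<gamma> \<sigma> (snd x))"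
       "continuous_on (A \<times> P) (\<lambda>x. nu_star bs \<gamma> \<sigma> (snd x))"
    by (rule continuous_on_compose2[OF _ continuous_on_snd[OF continuous_on_id]]; use assms in force)+
  then show ?thesis
    unfolding lyapunov_def split_def
    by (intro continuous_intros matrix_vector_mult_linear_continuous_on[THEN continuous_on_compose2])
      auto
qed

text \<open>
  The optima stay bounded over the compact set of channels, and the Lyapunov function dominates the
  squared distance from them, for \<open>\<tau>\<close> because \<open>E\<close> only scales the norm on the link space.
\<close>

lemma bounded_lyapunov_sublevel:
  fixes P :: "('n::finite, 'k::finite, 'b::finite) channels set"
  assumes rho_pos: "\<rho> > 0" and "compact P"
    and "continuous_on P (tau_star bs \<gamma> \<sigma>)" and "continuous_on P (nu_star bs \<gamma> \<sigma>)"
    and star_link: "\<And>H. H \<in> P \<Longrightarrow> tau_star bs \<gamma> \<sigma> H \<in> link_space bs"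
  shows "bounded {z \<in> admm_states bs. \<exists>H\<in>P. lyapunov bs \<gamma> \<sigma> \<rho> (snd z) (fst z) H \<le> M}"
proof -
  have "bounded (tau_star bs \<gamma> \<sigma> ` P)" "bounded (nu_star bs \<gamma> \<sigma> ` P)"
    using assms by (simp_all add: compact_continuous_image compact_imp_bounded)
  then obtain a b where a: "\<And>H. H \<in> P \<Longrightarrow> norm (tau_star bs \<gamma> \<sigma> H) \<le> a"
    and b: "\<And>H. H \<in> P \<Longrightarrow> norm (nu_star bs \<gamma> \<sigma> H) \<le> b"
    by (auto simp: bounded_iff)
  have "norm z \<le> (sqrt (M / (2 * \<rho>)) + a) + (sqrt (\<rho> * M) + b)"
    if z: "z \<in> admm_states bs" and H: "H \<in> P" and le: "lyapunov bs \<gamma> \<sigma> \<rho> (snd z) (fst z) H \<le> M" for z H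
  proof -
    obtain \<tau> \<nu> where z_eq: "z = (\<tau>, \<nu>)" by fastforce
    let ?d\<tau> = "\<tau> - tau_star bs \<gamma> \<sigma> H" and ?d\<nu> = "\<nu> - nu_star bs \<gamma> \<sigma> H"
    have "?d\<tau> \<in> link_space bs"
      using z star_link[OF H] by (simp add: z_eq admm_states_def subspace_diff subspace_link_space)
    then have V: "1 / \<rho> * (norm ?d\<nu>)\<^sup>2 + \<rho> * (2 * (norm ?d\<tau>)\<^sup>2) \<le> M"
      using le by (simp add: z_eq lyapunov_def norm_copy_matrix_mult)
    have "1 / \<rho> * (norm ?d\<nu>)\<^sup>2 \<ge> 0" "\<rho> * (2 * (norm ?d\<tau>)\<^sup>2) \<ge> 0"
      using rho_pos by simp_all
    then have "1 / \<rho> * (norm ?d\<nu>)\<^sup>2 \<le> M" "\<rho> * (2 * (norm ?d\<tau>)\<^sup>2) \<le> M"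
      using V by linarith+
    then have "(norm ?d\<nu>)\<^sup>2 \<le> \<rho> * M" "(norm ?d\<tau>)\<^sup>2 \<le> M / (2 * \<rho>)"
      using rho_pos by (simp_all add: field_simps)
    then have "norm ?d\<nu> \<le> sqrt (\<rho> * M)" "norm ?d\<tau> \<le> sqrt (M / (2 * \<rho>))"
      by (simp_all only: real_le_rsqrt)
    moreover have "norm \<nu> \<le> norm ?d\<nu> + norm (nu_star bs \<gamma> \<sigma> H)"
                  "norm \<tau> \<le> norm ?d\<tau> + norm (tau_star bs \<gamma> \<sigma> H)"
      using norm_triangle_ineq[of ?d\<nu> "nu_star bs \<gamma> \<sigma> H"]
        norm_triangle_ineq[of ?d\<tau> "tau_star bs \<gamma> \<sigma> H"] by simp_all
    moreover have "norm z \<le> norm \<tau> + norm \<nu>" by (simp add: z_eq norm_Pair_le)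
    ultimately show ?thesis using a[OF H] b[OF H] by linarith
  qed
  then show ?thesis
    by (intro boundedI[where B = "(sqrt (M / (2 * \<rho>)) + a) + (sqrt (\<rho> * M) + b)"]) blast
qed

lemma continuous_on_lyapunov_decrease:
  assumes t: "continuous_on (link_space bs \<times> copy_space bs \<times> P)
                 (\<lambda>(\<tau>, \<nu>, H). admm_t bs \<gamma> \<sigma> \<rho> \<tau> \<nu> H)"
    and tau: "continuous_on (link_space bs \<times> copy_space bs \<times> P)
                   (\<lambda>(\<tau>, \<nu>, H). admm_tau bs \<gamma> \<sigma> \<rho> \<tau> \<nu> H)"
  shows "continuous_on (admm_states bs \<times> P) (\<lambda>(z, H). lyapunov_decrease bs \<gamma> \<sigma> \<rho> z H)"
proof -
  have regroup: "continuous_on (admm_states bs \<times> P) (\<lambda>x. (fst (fst x), snd (fst x), snd x))"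
    by (intro continuous_intros)
  have sub: "(\<lambda>x. (fst (fst x), snd (fst x), snd x)) ` (admm_states bs \<times> P)
             \<subseteq> link_space bs \<times> copy_space bs \<times> P"
    by (auto simp: admm_states_def)
  have "continuous_on (admm_states bs \<times> P) (\<lambda>x. admm_t bs \<gamma> \<sigma> \<rho> (fst (fst x)) (snd (fst x)) (snd x))"
       "continuous_on (admm_states bs \<times> P) (\<lambda>x. admm_tau bs \<gamma> \<sigma> \<rho> (fst (fst x)) (snd (fst x)) (snd x))"
    using continuous_on_compose2[OF t regroup sub] continuous_on_compose2[OF tau regroup sub]
    by simp_all
  then show ?thesis
    unfolding lyapunov_decrease_def admm_nu_def split_def
    by (intro continuous_intros matrix_vector_mult_linear_continuous_on[THEN continuous_on_compose2])
      auto
qed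

lemma dynamic_admm_Suc:
  "dynamic_admm bs \<gamma> \<sigma> \<rho> \<tau>0 \<nu>0 H (Suc i)
   = admm_step bs \<gamma> \<sigma> \<rho> (dynamic_admm bs \<gamma> \<sigma> \<rho> \<tau>0 \<nu>0 H i) (H (Suc i))"
  by (simp add: admm_step_def split_def Let_def)

section \<open>Tracking under channel variation\<close>

text \<open>
  The channel variation may be measured in any norm; on a finite-dimensional space it controls the
  Euclidean one, by the minimum of the norm on the unit sphere.
\<close>

lemma is_norm_dominates_norm:
  fixes nrm :: "'a::euclidean_space \<Rightarrow> real"
  assumes "is_norm nrm"
  obtains \<kappa> where "\<kappa> > 0" "\<And>x. \<kappa> * norm x \<le> nrm x"
proof -
  have zero: "nrm x = 0 \<longleftrightarrow> x = 0" and scale: "nrm (a *\<^sub>R x) = \<bar>a\<bar> * nrm x"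
    and triangle: "nrm (x + y) \<le> nrm x + nrm y" for a x y
    using assms by (auto simp: is_norm_def)
  have nonneg: "nrm x \<ge> 0" for x
    using triangle[of x "(-1) *\<^sub>R x"] scale[of "-1" x] zero[of 0] by simp
  have "convex_on UNIV nrm"
  proof (rule convex_onI)
    fix t :: real and x y
    assume "0 < t" "t < 1"
    then show "nrm ((1 - t) *\<^sub>R x + t *\<^sub>R y) \<le> (1 - t) * nrm x + t * nrm y"
      using triangle[of "(1 - t) *\<^sub>R x" "t *\<^sub>R y"] by (simp add: scale)
  qed simp
  then have "continuous_on UNIV nrm"
    by (rule convex_on_continuous[OF open_UNIV])
  then have cont: "continuous_on (sphere 0 1) nrm"
    using continuous_on_subset by blast
  have "sphere (0::'a) 1 \<noteq> {}" by simp
  then obtain u where u: "u \<in> sphere 0 1" and u_min: "\<And>x. x \<in> sphere 0 1 \<Longrightarrow> nrm u \<le> nrm x"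
    using continuous_attains_inf[OF compact_sphere _ cont] by metis
  show thesis
  proof
    have "u \<noteq> 0" using u by auto
    then show "nrm u > 0" using nonneg[of u] zero[of u] by linarith
    show "nrm u * norm x \<le> nrm x" for x
    proof (cases "x = 0")
      case False
      have "nrm u \<le> nrm ((1 / norm x) *\<^sub>R x)"
        using False by (intro u_min) simp
      then show ?thesis using False by (simp add: scale field_simps)
    qed (simp add: nonneg)
  qed
qed

theorem lemma2:
  fixes bs :: "'k::finite \<Rightarrow> 'b::finite"
    and \<gamma> \<sigma> :: "'k \<Rightarrow> real"
    and \<H> :: "(('n::finite, 'k, 'b) channels) set"
    and nrm :: "('n, 'k, 'b) channels \<Rightarrow> real"
    and \<rho> c :: real
    and \<tau>0 :: "('k, 'b) link_vec"
    and \<nu>0 :: "('k, 'b) copy_vec"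
  assumes gamma_pos: "\<And>k. \<gamma> k > 0"
    and noise_pos: "\<And>k. (\<sigma> k)\<^sup>2 > 0"
    and nrm: "is_norm nrm"
    and compact: "compact \<H>"
    and feasible: "\<And>H. H \<in> \<H> \<Longrightarrow> strictly_feasible bs \<gamma> \<sigma> H"
    and rho_pos: "\<rho> > 0"
    and tau0: "\<tau>0 \<in> link_space bs"
    and nu0: "\<nu>0 \<in> copy_space bs"
    and nu0_kernel: "transpose (copy_matrix bs) *v \<nu>0 = 0"
    and tau_star_unique: "\<And>H. H \<in> \<H> \<Longrightarrow> \<exists>!\<tau>. optimal_tau bs \<gamma> \<sigma> H \<tau>"
    and nu_star_unique: "\<And>H. H \<in> \<H> \<Longrightarrow> \<exists>!\<nu>. optimal_multiplier bs \<gamma> \<sigma> H \<nu>"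
    and A1: "continuous_on \<H> (tau_star bs \<gamma> \<sigma>)"
    and A2: "continuous_on \<H> (nu_star bs \<gamma> \<sigma>)"
    and A3_W: "continuous_on (link_space bs \<times> copy_space bs \<times> \<H>)
                 (\<lambda>(\<tau>, \<nu>, H). admm_W bs \<gamma> \<sigma> \<rho> \<tau> \<nu> H)"
    and A3_t: "continuous_on (link_space bs \<times> copy_space bs \<times> \<H>)
                 (\<lambda>(\<tau>, \<nu>, H). admm_t bs \<gamma> \<sigma> \<rho> \<tau> \<nu> H)"
    and A3_tau: "continuous_on (link_space bs \<times> copy_space bs \<times> \<H>)
                   (\<lambda>(\<tau>, \<nu>, H). admm_tau bs \<gamma> \<sigma> \<rho> \<tau> \<nu> H)"
    and c_pos: "c > 0"
  shows "\<exists>\<delta>>0. \<forall>H :: nat \<Rightarrow> ('n, 'k, 'b) channels.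
           (\<forall>i\<ge>1. H (i - 1) \<in> \<H> \<and> nrm (H i - H (i - 1)) \<le> \<delta>) \<longrightarrow>
           limsup (\<lambda>i. let (\<tau>, \<nu>) = dynamic_admm bs \<gamma> \<sigma> \<rho> \<tau>0 \<nu>0 H (i - 1)
                       in ereal (lyapunov bs \<gamma> \<sigma> \<rho> \<nu> \<tau> (H i))) \<le> ereal c"
proof -
  let ?V = "\<lambda>z H. lyapunov bs \<gamma> \<sigma> \<rho> (snd z) (fst z) H"
  note star = star_saddle_point[OF tau_star_unique nu_star_unique]
  have star_link: "tau_star bs \<gamma> \<sigma> H \<in> link_space bs" if "H \<in> \<H>" for H
    by (rule star[OF that that])
  have nonempty: "admissible_set bs \<gamma> \<sigma> H \<noteq> {}" if "H \<in> \<H>" for H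
    by (rule star[OF that that]) blast
  have closed: "closed (admm_states bs)"
  proof -
    have "subspace {\<nu> \<in> copy_space bs. transpose (copy_matrix bs) *v \<nu> = 0}"
      using subspace_copy_space[of bs]
      by (auto simp: subspace_def matrix_vector_right_distrib matrix_vector_mult_scaleR)
    then show ?thesis
      unfolding admm_states_def
      by (intro closed_Times closed_subspace subspace_link_space)
  qed
  have start: "(\<tau>0, \<nu>0) \<in> admm_states bs"
    using tau0 nu0 nu0_kernel by (simp add: admm_states_def)
  have decrease_nonneg: "lyapunov_decrease bs \<gamma> \<sigma> \<rho> z H \<ge> 0" for z and H :: "('n, 'k, 'b) channels"
    using rho_pos by (simp add: lyapunov_decrease_def split_def)
  have descent: "?V (admm_step bs \<gamma> \<sigma> \<rho> z H) H + lyapunov_decrease bs \<gamma> \<sigma> \<rho> z H \<le> ?V z H"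
    if "z \<in> admm_states bs" "H \<in> \<H>" for z H
    using lyapunov_descent[of \<gamma>, OF gamma_pos rho_pos tau_star_unique nu_star_unique, OF that(2) that(2),
        of "snd z" "fst z"] that(1)
    by (auto simp: admm_states_def admm_step_def)
  have decrease_zero: "?V z H = 0"
    if "z \<in> admm_states bs" "H \<in> \<H>" "lyapunov_decrease bs \<gamma> \<sigma> \<rho> z H = 0" for z H
    using lyapunov_decrease_zero[of \<gamma>, OF gamma_pos rho_pos tau_star_unique nu_star_unique,
        OF that(2) that(2), of "fst z" "snd z"] that(1,3) by simp
  have "\<exists>d>0. \<forall>z H. z 0 = (\<tau>0, \<nu>0) \<longrightarrow> (\<forall>i. z (Suc i) = admm_step bs \<gamma> \<sigma> \<rho> (z i) (H (Suc i)))
      \<longrightarrow> (\<forall>i. H i \<in> \<H>) \<longrightarrow> (\<forall>i. dist (H (Suc i)) (H i) < d)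
      \<longrightarrow> (\<forall>\<^sub>F i in sequentially. ?V (z i) (H (Suc i)) \<le> c)"
    by (rule lyapunov_tracking[where V = ?V and D = "lyapunov_decrease bs \<gamma> \<sigma> \<rho>",
        OF closed compact start c_pos continuous_on_lyapunov[OF A1 A2]
          continuous_on_lyapunov_decrease[OF A3_t A3_tau]
          bounded_lyapunov_sublevel[OF rho_pos compact A1 A2 star_link]
          admm_step_in_admm_states[of \<gamma>, OF gamma_pos rho_pos nonempty]
          descent decrease_nonneg decrease_zero])
  then obtain d where "d > 0" and tracking: "\<forall>z H. z 0 = (\<tau>0, \<nu>0)
      \<longrightarrow> (\<forall>i. z (Suc i) = admm_step bs \<gamma> \<sigma> \<rho> (z i) (H (Suc i)))
      \<longrightarrow> (\<forall>i. H i \<in> \<H>) \<longrightarrow> (\<forall>i. dist (H (Suc i)) (H i) < d)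
      \<longrightarrow> (\<forall>\<^sub>F i in sequentially. ?V (z i) (H (Suc i)) \<le> c)"
    by (elim exE conjE) (rule that)
  obtain \<kappa> where "\<kappa> > 0" and \<kappa>: "\<And>x. \<kappa> * norm x \<le> nrm x"
    using is_norm_dominates_norm[OF nrm] by blast
  show ?thesis
  \<comment> \<open>Half of \<open>\<kappa> d\<close>, since the variation is bounded weakly by \<open>\<delta>\<close> but strictly by \<open>d\<close>.\<close>
  proof (intro exI[of _ "\<kappa> * d / 2"] conjI allI impI)
    show "\<kappa> * d / 2 > 0" using \<open>\<kappa> > 0\<close> \<open>d > 0\<close> by simp
    fix H :: "nat \<Rightarrow> ('n, 'k, 'b) channels"
    assume H: "\<forall>i\<ge>1. H (i - 1) \<in> \<H> \<and> nrm (H i - H (i - 1)) \<le> \<kappa> * d / 2"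
    let ?z = "dynamic_admm bs \<gamma> \<sigma> \<rho> \<tau>0 \<nu>0 H"
    have "H i \<in> \<H>" for i
      using H[rule_format, of "Suc i"] by simp
    moreover have "dist (H (Suc i)) (H i) < d" for i
    proof -
      have "\<kappa> * norm (H (Suc i) - H i) \<le> \<kappa> * (d / 2)"
        using H[rule_format, of "Suc i"] \<kappa>[of "H (Suc i) - H i"] by simp
      then show ?thesis
        using \<open>\<kappa> > 0\<close> \<open>d > 0\<close> by (simp add: dist_norm)
    qed
    ultimately have "\<forall>\<^sub>F i in sequentially. ?V (?z i) (H (Suc i)) \<le> c"
      by (intro tracking[rule_format]) (simp_all only: dynamic_admm.simps(1) dynamic_admm_Suc)
    then obtain N where N: "\<And>i. i \<ge> N \<Longrightarrow> ?V (?z i) (H (Suc i)) \<le> c"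
      by (auto simp: eventually_sequentially)
    have "\<forall>\<^sub>F i in sequentially. (let (\<tau>, \<nu>) = ?z (i - 1) in ereal (lyapunov bs \<gamma> \<sigma> \<rho> \<nu> \<tau> (H i))) \<le> ereal c"
      unfolding eventually_sequentially
    proof (intro exI[of _ "Suc N"] allI impI)
      fix i assume "Suc N \<le> i"
      then show "(let (\<tau>, \<nu>) = ?z (i - 1) in ereal (lyapunov bs \<gamma> \<sigma> \<rho> \<nu> \<tau> (H i))) \<le> ereal c"
        using N[of "i - 1"] by (simp add: split_def Let_def)
    qed
    then show "limsup (\<lambda>i. let (\<tau>, \<nu>) = ?z (i - 1) in ereal (lyapunov bs \<gamma> \<sigma> \<rho> \<nu> \<tau> (H i))) \<le> ereal c"
      by (rule Limsup_bounded)
  qed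
qed

end
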